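(* Let $r\ge2$, let $a_1,\dots,a_r$ be pairwise distinct positive real numbers, let $\alpha\ge0$, and let $(\mathbf n^{(N)})_{N\in\mathbb N}$ be a path-like sequence of multi-indices in $\mathbb N^r$ with limiting proportions $q_1,\dots,q_r\in(0,1)$ (see context). Let $\nu_N$ be the zero probability distribution of the rescaled multiple Laguerre polynomial (of the second kind) $$L_N^{(N\alpha;\,Na_1,\dots,Na_r)}(x).$$ Then $\nu_N$ converges weakly as $N\to\infty$ towards $$\mu_{\mathrm{MP}\left(\frac1{1+\alpha}\right)}\boxtimes\Big(\sum_{j=1}^r q_j\delta_{1/a_j}\Big).$$
   Context: $\mathbb N=\{0,1,2,\dots\}$. Path-like sequence: multi-indices $\mathbf n^{(N)}=(n_1^{(N)},\dots,n_r^{(N)})\in\mathbb N^r$, $N\in\mathbb N$, such that (a) $\sum_{i=1}^r n_i^{(N)}=N$ for every $N$; (b) $n_i^{(N+1)}\ge n_i^{(N)}$ for every $N$ and $1\le i\le r$; (c) there is $R\in\mathbb N$ such that $n_i^{(N+R)}\ge n_i^{(N)}+1$ for every $N$ and $1\le i\le r$; (d) there are $q_1,\dots,q_r\in(0,1)$ with $\lim_{N\to\infty}n_i^{(N)}/N=q_i$ for $1\le i\le r$. Multiple Laguerre polynomial of the second kind: for $\beta\ge0$ and pairwise distinct positive $b_1,\dots,b_r$, $L_N^{(\beta;\,b_1,\dots,b_r)}$ is the unique monic polynomial of degree $N$ such that for every $1\le j\le r$, with $w_j(x)=e^{(1-b_j)x}$, $$\int_0^{\infty}x^kL_N^{(\beta;\,b_1,\dots,b_r)}(x)\,w_j(x)\,x^{\beta}e^{-x}\,\mathrm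 dx=0,\qquad 0\le k\le n_j^{(N)}-1$$ (for these weights existence and uniqueness hold for every multi-index). The zero probability distribution of a polynomial of degree $N$ with complex zeros $z_1,\dots,z_N$ (with multiplicity) is $\frac1N\sum_{i=1}^N\delta_{z_i}$. Marchenko–Pastur distribution of parameter $\rho>0$ (rescaled): $$\mu_{\mathrm{MP}(\rho)}(\mathrm dx)=\max\Big(1-\frac1\rho,0\Big)\delta_0+\frac1{2\pi x}\sqrt{(\rho_+-x)(x-\rho_-)}\,\mathbf 1_{[\rho_-,\rho_+]}(x)\,\mathrm dx,\qquad \rho_\pm=(1\pm\sqrt\rho)^2/\rho.$$ Free multiplicative convolution: for a compactly supported probability measure $\lambda\ne\delta_0$ on $[0,+\infty)$, let $\chi_\lambda$ be the inverse for composition of formal series of $\sum_{k\ge1}\big(\int x^k\lambda(\mathrm dx)\big)z^k$, and $S_\lambda(z)=\frac{1+z}{z}\chi_\lambda(z)$. For two such measures $\lambda,\eta$, $\lambda\boxtimes\eta$ is the unique compactly supported probability measure on $[0,+\infty)$, different from $\delta_0$, with $S_{\lambda\boxtimes\eta}=S_\lambda S_\eta$. *)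

theory Defs
  imports
    "HOL-Probability.Probability"
    "HOL-Computational_Algebra.Computational_Algebra"
begin

text \<open>
  Multi-indices in \<open>\<nat>\<^sup>r\<close> are functions \<open>nat \<Rightarrow> nat\<close>, and \<open>r\<close>-tuples of reals are functions
  \<open>nat \<Rightarrow> real\<close>; in both cases only the values at \<open>1, \<dots>, r\<close> are used.
\<close>

definition path_like :: "nat \<Rightarrow> (nat \<Rightarrow> nat \<Rightarrow> nat) \<Rightarrow> (nat \<Rightarrow> real) \<Rightarrow> bool" where
  "path_like r n q \<longleftrightarrow>
     (\<forall>N. (\<Sum>i=1..r. n N i) = N) \<and>
     (\<forall>N. \<forall>i\<in>{1..r}. n (N + 1) i \<ge> n N i) \<and>
     (\<exists>R. \<forall>N. \<forall>i\<in>{1..r}. n (N + R) i \<ge> n N i + 1) \<and>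
     (\<forall>i\<in>{1..r}. 0 < q i \<and> q i < 1 \<and> (\<lambda>N. real (n N i) / real N) \<longlonglongrightarrow> q i)"

definition is_multiple_laguerre2 ::
    "nat \<Rightarrow> (nat \<Rightarrow> nat) \<Rightarrow> real \<Rightarrow> (nat \<Rightarrow> real) \<Rightarrow> real poly \<Rightarrow> bool" where
  "is_multiple_laguerre2 r n \<beta> b P \<longleftrightarrow>
     lead_coeff P = 1 \<and> degree P = (\<Sum>i=1..r. n i) \<and>
     (\<forall>j\<in>{1..r}. \<forall>k<n j.
        (LBINT x:{0..}. x ^ k * poly P x * exp ((1 - b j) * x) * (x powr \<beta> * exp (- x))) = 0)"

definition multiple_laguerre2 ::
    "nat \<Rightarrow> (nat \<Rightarrow> nat) \<Rightarrow> real \<Rightarrow> (nat \<Rightarrow> real) \<Rightarrow> real poly" where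
  "multiple_laguerre2 r n \<beta> b = (THE P. is_multiple_laguerre2 r n \<beta> b P)"

text \<open>
  The measure \<open>\<Sum>i\<in>I. w i \<delta>\<^bsub>x i\<^esub>\<close>, for a finite index set \<open>I\<close> and nonnegative weights \<open>w\<close>.
\<close>
definition atomic_measure ::
    "'i set \<Rightarrow> ('i \<Rightarrow> real) \<Rightarrow> ('i \<Rightarrow> 'a::topological_space) \<Rightarrow> 'a measure" where
  "atomic_measure I w x = distr (point_measure I (\<lambda>i. ennreal (w i))) borel x"

lemma emeasure_atomic_measure:
  assumes "finite I" "A \<in> sets borel"
  shows "emeasure (atomic_measure I w x) A = (\<Sum>i\<in>I. ennreal (w i) * indicator A (x i))"
proof -
  have "emeasure (atomic_measure I w x) A = (\<Sum>i\<in>{i\<in>I. x i \<in> A}. ennreal (w i))"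
    using assms unfolding atomic_measure_def
    by (subst emeasure_distr)
       (auto simp: point_measure_def emeasure_point_measure_finite[unfolded point_measure_def]
             space_point_measure[unfolded point_measure_def] intro!: sum.cong)
  also have "\<dots> = (\<Sum>i\<in>I. ennreal (w i) * indicator A (x i))"
    using assms by (intro sum.mono_neutral_cong_left) (auto simp: indicator_def)
  finally show ?thesis .
qed

text \<open>
  Summing over the multiset of zeros \<open>z\<^sub>1, \<dots>, z\<^sub>N\<close> is summing over the distinct zeros, each
  weighted by its multiplicity.
\<close>
definition zero_distribution :: "complex poly \<Rightarrow> complex measure" where
  "zero_distribution p =
     atomic_measure {z. poly p z = 0} (\<lambda>z. real (order z p) / real (degree p)) (\<lambda>z. z)"

text \<open>The zeros are a priori complex, whereas \<open>weak_conv_m\<close> only covers measures on the real line.\<close>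
definition converges_weakly ::
    "(nat \<Rightarrow> 'a::topological_space measure) \<Rightarrow> 'a measure \<Rightarrow> bool" where
  "converges_weakly \<nu> \<mu> \<longleftrightarrow>
     (\<forall>f :: 'a \<Rightarrow> real. continuous_on UNIV f \<and> bounded (range f) \<longrightarrow>
        (\<lambda>N. \<integral>x. f x \<partial>\<nu> N) \<longlonglongrightarrow> (\<integral>x. f x \<partial>\<mu>))"

definition mp_density :: "real \<Rightarrow> real \<Rightarrow> real" where
  "mp_density \<rho> x =
     (let \<rho>p = (1 + sqrt \<rho>)\<^sup>2 / \<rho>; \<rho>m = (1 - sqrt \<rho>)\<^sup>2 / \<rho>
      in 1 / (2 * pi * x) * sqrt ((\<rho>p - x) * (x - \<rho>m)) * indicator {\<rho>m..\<rho>p} x)"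

definition marchenko_pastur :: "real \<Rightarrow> real measure" where
  "marchenko_pastur \<rho> =
     measure_of UNIV (sets borel)
       (\<lambda>A. ennreal (max (1 - 1 / \<rho>) 0) * emeasure (return borel 0) A
            + emeasure (density lborel (\<lambda>x. ennreal (mp_density \<rho> x))) A)"

lemma sets_marchenko_pastur [simp]: "sets (marchenko_pastur \<rho>) = sets borel"
  unfolding marchenko_pastur_def by (metis sets.sets_measure_of_eq space_borel)

lemma emeasure_marchenko_pastur:
  assumes "A \<in> sets borel"
  shows "emeasure (marchenko_pastur \<rho>) A =
           ennreal (max (1 - 1 / \<rho>) 0) * indicator A 0
           + (\<integral>\<^sup>+x\<in>A. ennreal (mp_density \<rho> x) \<partial>lborel)"
proof -
  let ?D = "density lborel (\<lambda>x. ennreal (mp_density \<rho> x))"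
  let ?\<mu> = "\<lambda>A. ennreal (max (1 - 1 / \<rho>) 0) * emeasure (return borel (0::real)) A + emeasure ?D A"
  have meas: "(\<lambda>x. ennreal (mp_density \<rho> x)) \<in> borel_measurable lborel"
    unfolding mp_density_def Let_def by measurable
  have "emeasure (marchenko_pastur \<rho>) A = ?\<mu> A"
  proof (rule emeasure_measure_of[OF marchenko_pastur_def])
    show "sets borel \<subseteq> Pow UNIV" by simp
    show "A \<in> sets (marchenko_pastur \<rho>)" using assms by simp
    show "positive (sets (marchenko_pastur \<rho>)) ?\<mu>" by (simp add: positive_def)
    show "countably_additive (sets (marchenko_pastur \<rho>)) ?\<mu>"
    proof (rule countably_additiveI)
      fix B :: "nat \<Rightarrow> real set"
      assume B: "range B \<subseteq> sets (marchenko_pastur \<rho>)" "disjoint_family B"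
      then have "(\<Sum>i. emeasure (return borel (0::real)) (B i)) = emeasure (return borel 0) (\<Union>i. B i)"
        and "(\<Sum>i. emeasure ?D (B i)) = emeasure ?D (\<Union>i. B i)"
        by (intro suminf_emeasure; simp)+
      then show "(\<Sum>i. ?\<mu> (B i)) = ?\<mu> (\<Union>i. B i)"
        by (subst suminf_add[symmetric]) auto
    qed
  qed
  then show ?thesis using assms meas by (simp add: emeasure_density)
qed

text \<open>Compactly supported probability measures on \<open>[0, +\<infinity>)\<close> other than \<open>\<delta>\<^sub>0\<close>.\<close>
definition admissible :: "real measure \<Rightarrow> bool" where
  "admissible \<mu> \<longleftrightarrow>
     prob_space \<mu> \<and> sets \<mu> = sets borel \<and>
     (\<exists>K. compact K \<and> K \<subseteq> {0..} \<and> (AE x in \<mu>. x \<in> K)) \<and>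
     \<mu> \<noteq> return borel 0"

definition moment_series :: "real measure \<Rightarrow> real fps" where
  "moment_series \<mu> = Abs_fps (\<lambda>k. if k = 0 then 0 else \<integral>x. x ^ k \<partial>\<mu>)"

text \<open>
  The compositional inverse \<open>fps_inv\<close> requires a vanishing constant coefficient and a nonzero
  linear one; for an admissible measure the linear one is its mean, hence positive.
  The division by \<open>fps_X\<close> is exact.
\<close>
definition S_transform :: "real measure \<Rightarrow> real fps" where
  "S_transform \<mu> = (1 + fps_X) * fps_inv (moment_series \<mu>) / fps_X"

definition free_mult_conv :: "real measure \<Rightarrow> real measure \<Rightarrow> real measure" where
  "free_mult_conv \<mu> \<eta> =
     (THE \<tau>. admissible \<tau> \<and> S_transform \<tau> = S_transform \<mu> * S_transform \<eta>)"

end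

theory Submission
  imports Defs
begin

text \<open>
  The proof works with the logarithmic derivative of the reversed polynomial and obtains the
  functional equation of the S-transform as the limit of a linear differential equation.

  \<^emph>\<open>The polynomial is explicit.\<close> The Laplace transform takes \<open>x\<^bsup>m + \<beta>\<^esup>\<close> to
  \<open>\<Gamma>(m + \<beta> + 1) s\<^bsup>- m - \<beta> - 1\<^esup>\<close>. Orthogonality of \<open>\<Sum>p\<^sub>m x\<^sup>m\<close> therefore says that
  \<open>\<Sum>p\<^sub>m \<Gamma>(m + \<beta> + 1) t\<^sup>m\<close> is a multiple of \<open>\<Prod>(t - 1 / b\<^sub>j)\<^bsup>n\<^sub>j\<^esup>\<close>
  (\<open>is_multiple_laguerre2_iff\<close>). For \<open>\<beta> = N \<alpha>\<close> and \<open>b\<^sub>j = N a\<^sub>j\<close> the product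
  \<open>E\<^sub>N = \<Prod>(1 - x X)\<close> over the zeros \<open>x\<close> is then the image of
  \<open>Q\<^sub>N = \<Prod>(1 - X / a\<^sub>j)\<^bsup>n\<^sub>j\<^esup>\<close> under
  \<open>X\<^sup>k \<mapsto> M (M - 1) \<dots> (M - k + 1) (X / N)\<^sup>k\<close>, where \<open>M = (1 + \<alpha>) N\<close>
  (\<open>rescaled_laguerre_roots\<close>).

  \<^emph>\<open>The limit equation.\<close> Put \<open>\<theta> = X d/dX\<close>. This linear map carries multiplication by \<open>X\<close> to
  \<open>(X / N) (M - \<theta>)\<close>. If \<open>\<psi>\<^sub>N\<close> is the moment series of the zero distribution, then
  \<open>\<theta>E\<^sub>N = - N \<psi>\<^sub>N E\<^sub>N\<close>, and modulo terms of order \<open>1 / N\<close> the operator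
  \<open>(X / N) (M - \<theta>)\<close> multiplies \<open>Y E\<^sub>N\<close> by \<open>X (1 + \<alpha> + \<psi>\<^sub>N)\<close>. The first-order equation of \<open>Q\<^sub>N\<close> thus
  becomes \<open>\<psi> = \<psi>\<^sub>\<eta> \<circ> (X (1 + \<alpha> + \<psi>))\<close> for every coefficientwise limit \<open>\<psi>\<close> of the \<open>\<psi>\<^sub>N\<close>, where
  \<open>\<eta> = \<Sum>q\<^sub>j \<delta>\<close> at \<open>1 / a\<^sub>j\<close> (\<open>moment_series_limit_equation\<close>). In terms of compositional
  inverses this reads \<open>S = S\<^sub>\<eta> / (1 + \<alpha> + X)\<close> (\<open>S_transform_product\<close>), and \<open>1 / (1 + \<alpha> + X)\<close> is the
  S-transform of the Marchenko--Pastur distribution (\<open>S_transform_marchenko_pastur\<close>).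

  \<^emph>\<open>Compactness.\<close> The polynomial arises from \<open>x\<^sup>M\<close> by \<open>N\<close> operators \<open>1 - c d/dx\<close>. Each of them keeps the zeros
  positive, since the logarithmic derivative maps the upper half plane to the lower one, and a barrier
  argument bounds them uniformly in \<open>N\<close> (\<open>laguerre_poly_roots\<close>). So the zero distributions are tight,
  every weak limit point is compactly supported and has the S-transform above, and such a measure is
  unique because it is determined by its moments (\<open>admissible_eq_of_S_transform_eq\<close>). Hence the free
  convolution exists and is the limit of the whole sequence.
\<close>

section \<open>Passing to the limit in the moment series\<close>

definition falling_factorial :: "real \<Rightarrow> nat \<Rightarrow> real" where
  "falling_factorial M k = (\<Prod>i<k. M - real i)"

lemma falling_factorial_0 [simp]: "falling_factorial M 0 = 1"
  by (simp add: falling_factorial_def)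

lemma falling_factorial_Suc: "falling_factorial M (Suc k) = falling_factorial M k * (M - real k)"
  by (simp add: falling_factorial_def)

text \<open>Replacing \<open>X\<^sup>k\<close> by \<open>M (M - 1) \<dots> (M - k + 1) (X / s)\<^sup>k\<close> is what leads from the product
  \<open>\<Prod>(1 - X / a\<^sub>j)\<close> over the prescribed multiplicities to the reversed multiple Laguerre
  polynomial. Up to normalisation it is the finite free multiplicative convolution with a
  classical Laguerre polynomial.\<close>
definition laguerre_transform :: "real \<Rightarrow> real \<Rightarrow> real fps \<Rightarrow> real fps" where
  "laguerre_transform s M P = Abs_fps (\<lambda>k. fps_nth P k * falling_factorial M k / s ^ k)"

lemma laguerre_transform_add:
  "laguerre_transform s M (P + Q) = laguerre_transform s M P + laguerre_transform s M Q"
  by (rule fps_ext) (simp add: laguerre_transform_def ring_distribs add_divide_distrib)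

lemma laguerre_transform_const_mult:
  "laguerre_transform s M (fps_const c * P) = fps_const c * laguerre_transform s M P"
  by (rule fps_ext) (simp add: laguerre_transform_def)

lemma laguerre_transform_0 [simp]: "laguerre_transform s M 0 = 0"
  by (rule fps_ext) (simp add: laguerre_transform_def)

lemma laguerre_transform_sum:
  "laguerre_transform s M (\<Sum>j\<in>J. P j) = (\<Sum>j\<in>J. laguerre_transform s M (P j))"
  by (induction J rule: infinite_finite_induct) (simp_all add: laguerre_transform_add)

lemma laguerre_transform_X_deriv:
  "laguerre_transform s M (fps_X * fps_deriv P) = fps_X * fps_deriv (laguerre_transform s M P)"
proof (rule fps_ext)
  fix k show "laguerre_transform s M (fps_X * fps_deriv P) $ k
      = (fps_X * fps_deriv (laguerre_transform s M P)) $ k"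
    by (cases k) (simp_all add: laguerre_transform_def)
qed

text \<open>The transform commutes with the Euler operator \<open>\<theta> = X d/dX\<close> and carries multiplication by \<open>X\<close>
  to the operator \<open>(X / s) (M - \<theta>)\<close>, because
  \<open>M \<dots> (M - k) = M \<dots> (M - k + 1) \<cdot> (M - k)\<close>. So a differential equation with polynomial
  coefficients for \<open>P\<close> becomes one for its transform.\<close>
lemma laguerre_transform_X_mult:
  fixes P :: "real fps" and s M :: real
  assumes "s \<noteq> 0"
  defines "T \<equiv> laguerre_transform s M P"
  shows "laguerre_transform s M (fps_X * P)
    = fps_X * (fps_const (M / s) * T - fps_const (1 / s) * (fps_X * fps_deriv T))"
proof (rule fps_ext)
  fix k
  show "laguerre_transform s M (fps_X * P) $ k
    = (fps_X * (fps_const (M / s) * T - fps_const (1 / s) * (fps_X * fps_deriv T))) $ k"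
  proof (cases k)
    case (Suc l)
    have "(fps_X * fps_deriv T) $ l = real l * T $ l"
      by (cases l) simp_all
    then show ?thesis using assms
      by (simp add: Suc laguerre_transform_def falling_factorial_Suc field_simps)
  qed (simp add: laguerre_transform_def)
qed

text \<open>The metric on formal power series makes the coefficients eventually constant along a convergent
  sequence. What is needed here is the weaker topology in which each coefficient converges in
  \<open>\<real>\<close>.\<close>
definition fps_coeffwise_tendsto :: "(nat \<Rightarrow> real fps) \<Rightarrow> real fps \<Rightarrow> bool" where
  "fps_coeffwise_tendsto f F \<longleftrightarrow> (\<forall>k. (\<lambda>N. f N $ k) \<longlonglongrightarrow> F $ k)"

lemma fps_coeffwise_tendsto_const: "fps_coeffwise_tendsto (\<lambda>_. F) F"
  by (simp add: fps_coeffwise_tendsto_def)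

lemma fps_coeffwise_tendsto_fps_const:
  "c \<longlonglongrightarrow> c' \<Longrightarrow> fps_coeffwise_tendsto (\<lambda>N. fps_const (c N)) (fps_const c')"
  by (auto simp: fps_coeffwise_tendsto_def)

lemma fps_coeffwise_tendsto_add:
  "fps_coeffwise_tendsto f F \<Longrightarrow> fps_coeffwise_tendsto g G
    \<Longrightarrow> fps_coeffwise_tendsto (\<lambda>N. f N + g N) (F + G)"
  by (auto simp: fps_coeffwise_tendsto_def intro!: tendsto_intros)

lemma fps_coeffwise_tendsto_diff:
  "fps_coeffwise_tendsto f F \<Longrightarrow> fps_coeffwise_tendsto g G
    \<Longrightarrow> fps_coeffwise_tendsto (\<lambda>N. f N - g N) (F - G)"
  by (auto simp: fps_coeffwise_tendsto_def intro!: tendsto_intros)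

lemma fps_coeffwise_tendsto_uminus:
  "fps_coeffwise_tendsto f F \<Longrightarrow> fps_coeffwise_tendsto (\<lambda>N. - f N) (- F)"
  by (auto simp: fps_coeffwise_tendsto_def intro!: tendsto_intros)

lemma fps_coeffwise_tendsto_mult:
  "fps_coeffwise_tendsto f F \<Longrightarrow> fps_coeffwise_tendsto g G
    \<Longrightarrow> fps_coeffwise_tendsto (\<lambda>N. f N * g N) (F * G)"
  by (auto simp: fps_coeffwise_tendsto_def fps_mult_nth intro!: tendsto_intros)

lemma fps_coeffwise_tendsto_deriv:
  "fps_coeffwise_tendsto f F \<Longrightarrow> fps_coeffwise_tendsto (\<lambda>N. fps_deriv (f N)) (fps_deriv F)"
  by (auto simp: fps_coeffwise_tendsto_def intro!: tendsto_intros)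

lemma fps_coeffwise_tendsto_sum:
  "(\<And>j. j \<in> J \<Longrightarrow> fps_coeffwise_tendsto (f j) (F j))
    \<Longrightarrow> fps_coeffwise_tendsto (\<lambda>N. \<Sum>j\<in>J. f j N) (\<Sum>j\<in>J. F j)"
  by (auto simp: fps_coeffwise_tendsto_def fps_sum_nth intro!: tendsto_intros)

lemma fps_coeffwise_tendsto_unique:
  "fps_coeffwise_tendsto f F \<Longrightarrow> fps_coeffwise_tendsto f G \<Longrightarrow> F = G"
  by (rule fps_ext) (auto simp: fps_coeffwise_tendsto_def intro: LIMSEQ_unique)

lemmas fps_coeffwise_tendsto_intros =
  fps_coeffwise_tendsto_const fps_coeffwise_tendsto_fps_const fps_coeffwise_tendsto_add
  fps_coeffwise_tendsto_diff fps_coeffwise_tendsto_mult fps_coeffwise_tendsto_deriv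
  fps_coeffwise_tendsto_sum fps_coeffwise_tendsto_uminus

lemma fps_nth_0_prod: "(\<Prod>j\<in>J. f j :: real fps) $ 0 = (\<Prod>j\<in>J. f j $ 0)"
  by (induction J rule: infinite_finite_induct) simp_all

text \<open>Let \<open>\<theta>E = - s \<psi> E\<close>. Then \<open>(X / s) (M - \<theta>)\<close> maps \<open>Z E\<close> to
  \<open>X ((M / s + \<psi>) Z - \<theta>Z / s) E\<close>. With \<open>M / s = l\<close> fixed and \<open>s \<rightarrow> \<infinity>\<close> the derivative drops out, and in the
  limit the operator is multiplication by \<open>W = X (l + \<Psi>)\<close>. Iterating this, multiplication by a polynomial \<open>A\<close>
  before the transform becomes multiplication by \<open>A \<circ> W\<close> in the limit.\<close>
lemma laguerre_transform_poly_mult_tendsto: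
  fixes A :: "real poly" and s :: "nat \<Rightarrow> real" and E \<psi> P Y :: "nat \<Rightarrow> real fps"
  assumes s: "\<And>k. s k > 0" "(\<lambda>k. 1 / s k) \<longlonglongrightarrow> 0"
    and E: "\<And>k. fps_X * fps_deriv (E k) = - fps_const (s k) * \<psi> k * E k"
    and \<psi>: "fps_coeffwise_tendsto \<psi> \<Psi>"
    and W: "W = fps_X * (fps_const l + \<Psi>)"
    and P: "\<And>k. laguerre_transform (s k) (l * s k) (P k) = Y k * E k"
    and Y: "fps_coeffwise_tendsto Y Y'"
  shows "\<exists>Z. (\<forall>k. laguerre_transform (s k) (l * s k) (fps_of_poly A * P k) = Z k * E k) \<and>
             fps_coeffwise_tendsto Z (fps_compose (fps_of_poly A) W * Y')"
proof (induction A)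
  case 0
  show ?case by (rule exI[of _ "\<lambda>_. 0"]) (auto intro: fps_coeffwise_tendsto_intros)
next
  case (pCons a A)
  then obtain Z where Z: "\<And>k. laguerre_transform (s k) (l * s k) (fps_of_poly A * P k) = Z k * E k"
    and Zlim: "fps_coeffwise_tendsto Z (fps_compose (fps_of_poly A) W * Y')"
    by blast
  define Z' where "Z' k = fps_const a * Y k
    + fps_X * ((fps_const l + \<psi> k) * Z k - fps_const (1 / s k) * (fps_X * fps_deriv (Z k)))" for k
  have "laguerre_transform (s k) (l * s k) (fps_of_poly (pCons a A) * P k) = Z' k * E k" for k
  proof -
    have nz: "s k \<noteq> 0" using s(1)[of k] by simp
    have c: "fps_const (1 / s k) * fps_const (s k) = 1"
      using nz by (simp flip: fps_const_mult)
    have "fps_of_poly (pCons a A) * P k = fps_const a * P k + fps_X * (fps_of_poly A * P k)"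
      by (simp add: fps_of_poly_pCons algebra_simps)
    then have "laguerre_transform (s k) (l * s k) (fps_of_poly (pCons a A) * P k)
        = fps_const a * (Y k * E k) + fps_X * (fps_const (l * s k / s k) * (Z k * E k)
          - fps_const (1 / s k) * (fps_X * fps_deriv (Z k * E k)))"
      by (simp add: laguerre_transform_add laguerre_transform_const_mult
          laguerre_transform_X_mult[OF nz] P Z)
    also have "fps_X * fps_deriv (Z k * E k)
        = fps_X * fps_deriv (Z k) * E k - fps_const (s k) * \<psi> k * Z k * E k"
    proof -
      have "fps_X * fps_deriv (Z k * E k)
          = fps_X * fps_deriv (Z k) * E k + Z k * (fps_X * fps_deriv (E k))"
        by (simp add: algebra_simps)
      then show ?thesis unfolding E by (simp add: algebra_simps del: fps_const_neg)
    qed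
    also have "fps_const (1 / s k) * \<dots>
        = fps_const (1 / s k) * (fps_X * fps_deriv (Z k)) * E k
          - (fps_const (1 / s k) * fps_const (s k)) * \<psi> k * Z k * E k"
      by (simp only: algebra_simps)
    finally show ?thesis
      unfolding c using nz by (simp add: Z'_def algebra_simps)
  qed
  moreover have "fps_coeffwise_tendsto Z' (fps_const a * Y'
      + fps_X * ((fps_const l + \<Psi>) * (fps_compose (fps_of_poly A) W * Y')
         - fps_const 0 * (fps_X * fps_deriv (fps_compose (fps_of_poly A) W * Y'))))"
    unfolding Z'_def using s(2) Y Zlim \<psi> by (intro fps_coeffwise_tendsto_intros)
  moreover have "fps_compose (fps_of_poly (pCons a A)) W
      = fps_const a + W * fps_compose (fps_of_poly A) W"
    using W by (simp add: fps_of_poly_pCons fps_compose_add_distrib fps_compose_mult_distrib)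
  ultimately show ?case
    by (intro exI[of _ Z']) (simp add: W algebra_simps)
qed

definition geometric_tail :: "real \<Rightarrow> real fps" where
  "geometric_tail x = Abs_fps (\<lambda>k. if k = 0 then 0 else x ^ k)"

lemma geometric_tail_mult: "(1 - fps_const x * fps_X) * geometric_tail x = fps_const x * fps_X"
proof (rule fps_ext)
  fix k
  show "((1 - fps_const x * fps_X) * geometric_tail x) $ k = (fps_const x * fps_X) $ k"
    by (cases k) (auto simp: geometric_tail_def algebra_simps)
qed

lemma fps_of_poly_linear: "fps_of_poly [:1, - x:] = 1 - fps_const x * fps_X" for x :: real
  by (simp add: fps_of_poly_pCons flip: fps_const_neg)

definition atomic_moment_series :: "'j set \<Rightarrow> ('j \<Rightarrow> real) \<Rightarrow> ('j \<Rightarrow> real) \<Rightarrow> real fps" where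
  "atomic_moment_series J q c = Abs_fps (\<lambda>k. if k = 0 then 0 else (\<Sum>j\<in>J. q j * c j ^ k))"

lemma atomic_moment_series_mult:
  assumes "finite J"
  shows "(\<Prod>j\<in>J. 1 - fps_const (c j) * fps_X) * atomic_moment_series J q c
    = (\<Sum>j\<in>J. fps_const (q j) * (fps_const (c j) * fps_X * (\<Prod>i\<in>J-{j}. 1 - fps_const (c i) * fps_X)))"
proof -
  let ?g = geometric_tail
  have "atomic_moment_series J q c = (\<Sum>j\<in>J. fps_const (q j) * ?g (c j))"
    by (rule fps_ext) (simp add: atomic_moment_series_def geometric_tail_def fps_sum_nth)
  moreover have "(\<Prod>j\<in>J. 1 - fps_const (c j) * fps_X) * (fps_const (q j) * ?g (c j))
      = fps_const (q j) * (fps_const (c j) * fps_X * (\<Prod>i\<in>J-{j}. 1 - fps_const (c i) * fps_X))"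
    if "j \<in> J" for j
  proof -
    have "(\<Prod>i\<in>J. 1 - fps_const (c i) * fps_X)
      = (1 - fps_const (c j) * fps_X) * (\<Prod>i\<in>J-{j}. 1 - fps_const (c i) * fps_X)"
      by (rule prod.remove[OF assms that])
    then show ?thesis using geometric_tail_mult[of "c j"] by (simp add: mult_ac)
  qed
  ultimately show ?thesis by (simp only: sum_distrib_left cong: sum.cong)
qed

text \<open>The logarithmic derivative of the product, with the denominators cleared.\<close>
lemma fps_deriv_prod_linear_power:
  assumes "finite J"
  shows "(\<Prod>j\<in>J. 1 - fps_const (c j) * fps_X) * (fps_X * fps_deriv (\<Prod>j\<in>J. (1 - fps_const (c j) * fps_X) ^ n j))
    = - (\<Sum>j\<in>J. fps_const (real (n j)) * (fps_const (c j) * fps_X * (\<Prod>i\<in>J-{j}. 1 - fps_const (c i) * fps_X)))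
        * (\<Prod>j\<in>J. (1 - fps_const (c j) * fps_X) ^ n j)"
  using assms
proof (induction J)
  case (insert j J)
  define u where "u = 1 - fps_const (c j) * fps_X"
  define A where "A = (\<Prod>j\<in>J. 1 - fps_const (c j) * fps_X)"
  define Q where "Q = (\<Prod>j\<in>J. (1 - fps_const (c j) * fps_X) ^ n j)"
  define B where "B = (\<Sum>j\<in>J. fps_const (real (n j)) * (fps_const (c j) * fps_X * (\<Prod>i\<in>J-{j}. 1 - fps_const (c i) * fps_X)))"
  have IH: "A * (fps_X * fps_deriv Q) = - B * Q"
    using insert.IH by (simp add: A_def B_def Q_def)
  have "(\<Sum>i\<in>J. fps_const (real (n i)) * (fps_const (c i) * fps_X * (\<Prod>i\<in>insert j J-{i}. 1 - fps_const (c i) * fps_X)))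
      = u * B"
    unfolding B_def sum_distrib_left
  proof (rule sum.cong)
    fix i assume i: "i \<in> J"
    have "insert j J - {i} = insert j (J - {i})" using insert.hyps i by auto
    then show "fps_const (real (n i)) * (fps_const (c i) * fps_X * (\<Prod>i\<in>insert j J-{i}. 1 - fps_const (c i) * fps_X))
      = u * (fps_const (real (n i)) * (fps_const (c i) * fps_X * (\<Prod>i\<in>J-{i}. 1 - fps_const (c i) * fps_X)))"
      using insert.hyps by (simp add: u_def mult_ac)
  qed simp
  moreover have "insert j J - {j} = J" using insert.hyps by auto
  ultimately have B': "(\<Sum>i\<in>insert j J. fps_const (real (n i)) * (fps_const (c i) * fps_X * (\<Prod>i\<in>insert j J-{i}. 1 - fps_const (c i) * fps_X)))
     = fps_const (real (n j)) * (fps_const (c j) * fps_X * A) + u * B"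
    using insert.hyps by (simp add: A_def)
  have du: "u * fps_deriv (u ^ n j) = - (fps_const (real (n j)) * fps_const (c j) * u ^ n j)"
  proof (cases "n j")
    case (Suc m)
    have "fps_deriv u = - fps_const (c j)" by (simp add: u_def)
    then have "fps_deriv (u ^ n j) = fps_const (real (n j)) * (- fps_const (c j)) * u ^ m"
      unfolding fps_deriv_power by (simp add: Suc)
    then show ?thesis
      unfolding Suc power_Suc by (simp only: mult_minus_left mult_minus_right ac_simps)
  qed simp
  have "u * A * (fps_X * fps_deriv (u ^ n j * Q))
     = fps_X * A * Q * (u * fps_deriv (u ^ n j)) + u * u ^ n j * (A * (fps_X * fps_deriv Q))"
    by (simp add: algebra_simps)
  also have "\<dots> = - (fps_const (real (n j)) * (fps_const (c j) * fps_X * A) + u * B) * (u ^ n j * Q)"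
    unfolding du IH by (simp add: algebra_simps)
  finally show ?case
    unfolding B' using insert.hyps by (simp add: u_def A_def Q_def)
qed simp

text \<open>\<open>Q = \<Prod>(1 - c\<^sub>j X)\<^bsup>n\<^sub>j\<^esup>\<close> satisfies the first-order equation
  \<open>\<theta>Q = - (\<Sum>n\<^sub>j c\<^sub>j X / (1 - c\<^sub>j X)) Q\<close>. Its transform \<open>E\<close> satisfies the transformed equation; divided by \<open>s E\<close>
  it becomes, in the limit, \<open>\<Psi> = \<Sum>q\<^sub>j c\<^sub>j W / (1 - c\<^sub>j W)\<close>, whose right-hand side is the
  moment series of \<open>\<Sum>q\<^sub>j \<delta>\<close> at \<open>c\<^sub>j\<close>, composed with \<open>W = X (l + \<Psi>)\<close>.\<close>
theorem moment_series_limit_equation: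
  fixes s :: "nat \<Rightarrow> real" and n :: "nat \<Rightarrow> 'j \<Rightarrow> nat"
  assumes "finite J"
    and s: "\<And>k. s k > 0" "(\<lambda>k. 1 / s k) \<longlonglongrightarrow> 0"
    and q: "\<And>j. j \<in> J \<Longrightarrow> (\<lambda>k. real (n k j) / s k) \<longlonglongrightarrow> q j"
    and E: "\<And>k. fps_X * fps_deriv (E k) = - fps_const (s k) * \<psi> k * E k"
    and E_eq: "\<And>k. E k = laguerre_transform (s k) (l * s k) (\<Prod>j\<in>J. (1 - fps_const (c j) * fps_X) ^ n k j)"
    and \<psi>: "fps_coeffwise_tendsto \<psi> \<Psi>"
  shows "\<Psi> = fps_compose (atomic_moment_series J q c) (fps_X * (fps_const l + \<Psi>))"
proof -
  define W where "W = fps_X * (fps_const l + \<Psi>)"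
  define Q where "Q k = (\<Prod>j\<in>J. (1 - fps_const (c j) * fps_X) ^ n k j)" for k
  define A where "A = (\<Prod>j\<in>J. [:1, - c j:])"
  define B where "B j = [:0, c j:] * (\<Prod>i\<in>J-{j}. [:1, - c i:])" for j
  have A: "fps_of_poly A = (\<Prod>j\<in>J. 1 - fps_const (c j) * fps_X)"
    by (simp add: A_def fps_of_poly_prod fps_of_poly_linear)
  have B: "fps_of_poly (B j) = fps_const (c j) * fps_X * (\<Prod>i\<in>J-{j}. 1 - fps_const (c i) * fps_X)" for j
  proof -
    have "fps_of_poly [:0, c j:] = fps_const (c j) * fps_X"
      by (simp add: fps_of_poly_pCons)
    then show ?thesis
      by (simp only: B_def fps_of_poly_mult fps_of_poly_prod fps_of_poly_linear)
  qed
  have W0: "W $ 0 = 0" by (simp add: W_def)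
  have E0: "E k \<noteq> 0" for k
  proof -
    have "Q k $ 0 = 1" using \<open>finite J\<close> by (simp add: Q_def fps_nth_0_prod fps_power_zeroth)
    then have "E k $ 0 = 1" by (simp add: E_eq laguerre_transform_def flip: Q_def)
    then show ?thesis by auto
  qed
  note lim = laguerre_transform_poly_mult_tendsto[OF s E \<psi> W_def]
  have TQ': "laguerre_transform (s k) (l * s k) (fps_const (1 / s k) * (fps_X * fps_deriv (Q k)))
      = - \<psi> k * E k" for k
  proof -
    have c: "fps_const (1 / s k) * fps_const (s k) = 1"
      using s(1)[of k] by (simp flip: fps_const_mult)
    have "laguerre_transform (s k) (l * s k) (fps_const (1 / s k) * (fps_X * fps_deriv (Q k)))
      = fps_const (1 / s k) * (fps_X * fps_deriv (E k))"
      by (simp add: laguerre_transform_const_mult laguerre_transform_X_deriv E_eq Q_def)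
    also have "\<dots> = - (fps_const (1 / s k) * fps_const (s k)) * \<psi> k * E k"
      unfolding E by (simp add: ac_simps del: fps_const_mult fps_const_neg)
    finally show ?thesis unfolding c by simp
  qed
  obtain Z where Z: "\<And>k. laguerre_transform (s k) (l * s k)
        (fps_of_poly A * (fps_const (1 / s k) * (fps_X * fps_deriv (Q k)))) = Z k * E k"
    and Zlim: "fps_coeffwise_tendsto Z (fps_compose (fps_of_poly A) W * (- \<Psi>))"
    using lim[OF TQ' fps_coeffwise_tendsto_uminus[OF \<psi>], of A] by blast
  have "laguerre_transform (s k) (l * s k) (Q k) = 1 * E k" for k
    by (simp add: E_eq Q_def)
  then have "\<exists>Z. (\<forall>k. laguerre_transform (s k) (l * s k) (fps_of_poly (B j) * Q k) = Z k * E k) \<and>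
      fps_coeffwise_tendsto Z (fps_compose (fps_of_poly (B j)) W * 1)" for j
    by (rule lim[OF _ fps_coeffwise_tendsto_const])
  then obtain Y where Y: "\<And>j k. laguerre_transform (s k) (l * s k) (fps_of_poly (B j) * Q k) = Y j k * E k"
    and Ylim: "\<And>j. fps_coeffwise_tendsto (Y j) (fps_compose (fps_of_poly (B j)) W * 1)"
    by metis
  have "Z k = - (\<Sum>j\<in>J. fps_const (real (n k j) / s k) * Y j k)" for k
  proof -
    have neg: "fps_const (- 1) * x = - x" for x :: "real fps"
      by (simp flip: fps_const_neg)
    have split_const: "fps_const (real m / s k) = fps_const (1 / s k) * fps_const (real m)" for m
      by simp
    have "fps_of_poly A * (fps_X * fps_deriv (Q k))
        = - (\<Sum>j\<in>J. fps_const (real (n k j)) * fps_of_poly (B j)) * Q k"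
      unfolding A B Q_def by (rule fps_deriv_prod_linear_power[OF \<open>finite J\<close>])
    then have "fps_of_poly A * (fps_const (1 / s k) * (fps_X * fps_deriv (Q k)))
        = fps_const (1 / s k) * (- (\<Sum>j\<in>J. fps_const (real (n k j)) * fps_of_poly (B j)) * Q k)"
      by (metis mult.left_commute)
    also have "\<dots> = fps_const (-1) * (\<Sum>j\<in>J. fps_const (real (n k j) / s k) * (fps_of_poly (B j) * Q k))"
      unfolding neg split_const by (simp only: sum_distrib_left sum_distrib_right mult.assoc
          mult_minus_left mult_minus_right)
    finally have "Z k * E k = fps_const (-1) * (\<Sum>j\<in>J. fps_const (real (n k j) / s k) * (Y j k * E k))"
      by (simp only: flip: Z Y) (simp only: laguerre_transform_const_mult laguerre_transform_sum)
    then have "Z k * E k = (- (\<Sum>j\<in>J. fps_const (real (n k j) / s k) * Y j k)) * E k"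
      unfolding neg by (simp only: sum_distrib_right mult.assoc mult_minus_left)
    then show ?thesis using mult_right_cancel[OF E0[of k]] by blast
  qed
  then have Z_eq: "Z = (\<lambda>k. - (\<Sum>j\<in>J. fps_const (real (n k j) / s k) * Y j k))" by blast
  have "fps_coeffwise_tendsto Z (- (\<Sum>j\<in>J. fps_const (q j) * (fps_compose (fps_of_poly (B j)) W * 1)))"
    unfolding Z_eq by (intro fps_coeffwise_tendsto_intros q Ylim)
  \<comment> \<open>Both limits of \<open>Z\<close> agree; this is the limit equation multiplied by the denominators.\<close>
  from fps_coeffwise_tendsto_unique[OF Zlim this]
  have 1: "fps_compose (fps_of_poly A) W * \<Psi> = (\<Sum>j\<in>J. fps_const (q j) * fps_compose (fps_of_poly (B j)) W)"
    by simp
  have "fps_compose (fps_of_poly A * atomic_moment_series J q c) W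
      = fps_compose (\<Sum>j\<in>J. fps_const (q j) * fps_of_poly (B j)) W"
    unfolding A B by (subst atomic_moment_series_mult[OF \<open>finite J\<close>]) simp
  then have 2: "fps_compose (fps_of_poly A) W * fps_compose (atomic_moment_series J q c) W
      = (\<Sum>j\<in>J. fps_const (q j) * fps_compose (fps_of_poly (B j)) W)"
    by (simp add: fps_compose_mult_distrib[OF W0] fps_compose_sum_distrib)
  have "fps_compose (fps_of_poly A) W $ 0 = 1"
    using \<open>finite J\<close> by (simp add: A fps_nth_0_prod)
  then have nz: "fps_compose (fps_of_poly A) W \<noteq> 0" by (metis fps_zero_nth zero_neq_one)
  have "fps_compose (fps_of_poly A) W * \<Psi>
      = fps_compose (fps_of_poly A) W * fps_compose (atomic_moment_series J q c) W"
    using 1 2 by simp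
  then show ?thesis
    unfolding W_def[symmetric] using mult_left_cancel[OF nz] by blast
qed

section \<open>Positivity and boundedness of the zeros\<close>

definition poly_of_roots :: "'a::comm_ring_1 multiset \<Rightarrow> 'a poly" where
  "poly_of_roots A = (\<Prod>x\<in>#A. [:- x, 1:])"

lemma poly_of_roots_empty [simp]: "poly_of_roots {#} = 1"
  by (simp add: poly_of_roots_def)

lemma poly_of_roots_add_mset [simp]: "poly_of_roots (add_mset x A) = [:- x, 1:] * poly_of_roots A"
  by (simp add: poly_of_roots_def)

lemma poly_of_roots_nonzero [simp]: "poly_of_roots (A :: 'a::idom multiset) \<noteq> 0"
  by (induction A) (simp_all del: mult_pCons_left)

lemma poly_of_roots_root_iff:
  "poly (poly_of_roots (A :: 'a::idom multiset)) z = 0 \<longleftrightarrow> z \<in># A"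
  by (induction A) (auto simp: eq_neg_iff_add_eq_0)

lemma degree_poly_of_roots [simp]: "degree (poly_of_roots (A :: 'a::idom multiset)) = size A"
  by (induction A) (simp_all add: degree_mult_eq del: mult_pCons_left)

lemma lead_coeff_poly_of_roots: "lead_coeff (poly_of_roots (A :: 'a::idom multiset)) = 1"
  by (induction A) (simp_all add: lead_coeff_mult del: mult_pCons_left degree_poly_of_roots)

lemma proots_poly_of_roots: "proots (poly_of_roots (A :: 'a::idom multiset)) = A"
  by (induction A) (simp_all add: proots_mult del: mult_pCons_left)

lemma poly_pderiv_poly_of_roots:
  fixes A :: "'a::{idom, field} multiset"
  assumes "z \<notin># A"
  shows "poly (pderiv (poly_of_roots A)) z = poly (poly_of_roots A) z * (\<Sum>x\<in>#A. 1 / (z - x))"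
  using assms
proof (induction A)
  case (add x A)
  have "z - x \<noteq> 0" using add.prems by auto
  moreover have "poly (pderiv (poly_of_roots (add_mset x A))) z
      = (z - x) * poly (pderiv (poly_of_roots A)) z + poly (poly_of_roots A) z"
    by (simp only: poly_of_roots_add_mset pderiv_mult) (simp add: pderiv_pCons algebra_simps)
  moreover have "poly (poly_of_roots (add_mset x A)) z = (z - x) * poly (poly_of_roots A) z"
    by (simp add: algebra_simps)
  moreover have "poly (pderiv (poly_of_roots A)) z = poly (poly_of_roots A) z * (\<Sum>x\<in>#A. 1 / (z - x))"
    using add by simp
  ultimately show ?case
    by (simp only: image_mset_add_mset sum_mset.add_mset) (simp add: distrib_left mult.commute)
qed simp

lemma map_poly_of_real_mult:
  "map_poly complex_of_real (p * q) = map_poly complex_of_real p * map_poly complex_of_real q"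
  by (rule poly_eqI) (simp add: coeff_map_poly coeff_mult)

lemma map_poly_of_real_poly_of_roots:
  "map_poly complex_of_real (poly_of_roots A) = poly_of_roots (image_mset complex_of_real A)"
proof (induction A)
  case (add x A)
  then show ?case
    by (simp only: poly_of_roots_add_mset map_poly_of_real_mult image_mset_add_mset)
       (simp add: map_poly_pCons)
qed simp

text \<open>This is \<open>1 - c d/dx\<close> acting on \<open>f = x\<^sup>\<gamma> g\<close>, with the power of \<open>x\<close> split off:
  \<open>f - c f' = x\<^bsup>\<gamma> - 1\<^esup> (x g - c (\<gamma> g + x g'))\<close>.\<close>
definition laguerre_step :: "real \<Rightarrow> real \<Rightarrow> 'a::real_normed_field poly \<Rightarrow> 'a poly" where
  "laguerre_step \<gamma> c g =
     pCons 0 g - smult (of_real c) (smult (of_real \<gamma>) g + pCons 0 (pderiv g))"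

lemma coeff_laguerre_step_Suc:
  "coeff (laguerre_step \<gamma> c g) (Suc l)
    = coeff g l - of_real c * (of_real \<gamma> + of_nat (Suc l)) * coeff g (Suc l)"
  by (simp add: laguerre_step_def coeff_pderiv algebra_simps)

lemma degree_lead_coeff_laguerre_step:
  assumes "lead_coeff g = 1"
  shows "degree (laguerre_step \<gamma> c g) = Suc (degree g)" "lead_coeff (laguerre_step \<gamma> c g) = 1"
proof -
  have top: "coeff (laguerre_step \<gamma> c g) (Suc (degree g)) = 1"
    using assms by (simp add: coeff_laguerre_step_Suc coeff_eq_0)
  moreover have "coeff (laguerre_step \<gamma> c g) k = 0" if "k > Suc (degree g)" for k
  proof (cases k)
    case (Suc l)
    then show ?thesis using that by (simp add: coeff_laguerre_step_Suc coeff_eq_0)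
  qed (use that in simp)
  ultimately show "degree (laguerre_step \<gamma> c g) = Suc (degree g)"
    by (intro antisym degree_le le_degree) auto
  with top show "lead_coeff (laguerre_step \<gamma> c g) = 1" by simp
qed

lemma map_poly_laguerre_step:
  "map_poly complex_of_real (laguerre_step \<gamma> c g) = laguerre_step \<gamma> c (map_poly complex_of_real g)"
proof (rule poly_eqI)
  fix k
  show "coeff (map_poly complex_of_real (laguerre_step \<gamma> c g)) k
      = coeff (laguerre_step \<gamma> c (map_poly complex_of_real g)) k"
  proof (cases k)
    case (Suc l)
    then show ?thesis by (simp add: coeff_map_poly coeff_laguerre_step_Suc)
  qed (simp add: coeff_map_poly laguerre_step_def)
qed

text \<open>The logarithmic derivative of \<open>f = x\<^sup>\<gamma> \<Prod>(x - a)\<close>. Where \<open>f\<close> does not vanish, \<open>f - c f'\<close> vanishes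
  exactly if it equals \<open>1 / c\<close>.\<close>
definition log_deriv :: "real \<Rightarrow> 'a::real_normed_field multiset \<Rightarrow> 'a \<Rightarrow> 'a" where
  "log_deriv \<gamma> A z = of_real \<gamma> / z + (\<Sum>x\<in>#A. 1 / (z - x))"

lemma poly_laguerre_step_log_deriv:
  assumes "z \<noteq> 0" "z \<notin># A"
  shows "poly (laguerre_step \<gamma> c (poly_of_roots A)) z
    = z * poly (poly_of_roots A) z * (1 - of_real c * log_deriv \<gamma> A z)"
  using assms by (simp add: laguerre_step_def log_deriv_def poly_pderiv_poly_of_roots field_simps)

lemma Im_sum_inverse_nonpos:
  assumes "Im z > 0"
  shows "Im (\<Sum>x\<in>#image_mset complex_of_real A. 1 / (z - x)) \<le> 0"
proof (induction A)
  case (add x A)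
  have "Im (1 / (z - complex_of_real x)) \<le> 0"
    using assms by (simp add: Im_divide divide_nonpos_nonneg)
  with add show ?case by simp
qed simp

text \<open>Each summand \<open>1 / (z - x)\<close> of the logarithmic derivative maps the upper half plane to the lower
  one, so the sum cannot take the real value \<open>1 / c\<close> there.\<close>
lemma laguerre_step_no_upper_half_plane_roots:
  assumes "\<gamma> > 0" "c > 0" "Im z > 0"
  shows "poly (laguerre_step \<gamma> c (poly_of_roots (image_mset complex_of_real A))) z \<noteq> 0"
proof
  let ?A = "image_mset complex_of_real A"
  assume 0: "poly (laguerre_step \<gamma> c (poly_of_roots ?A)) z = 0"
  have z: "z \<noteq> 0" "z \<notin># ?A" using assms by auto
  then have "poly (poly_of_roots ?A) z \<noteq> 0"
    using poly_of_roots_root_iff[of ?A z] by simp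
  with 0 z have 1: "1 = of_real c * log_deriv \<gamma> ?A z"
    by (simp add: poly_laguerre_step_log_deriv)
  have "Im (of_real \<gamma> / z) < 0"
    using assms z by (simp add: Im_divide divide_neg_pos sum_power2_gt_zero_iff complex_eq_iff)
  then have "Im (log_deriv \<gamma> ?A z) < 0"
    unfolding log_deriv_def using Im_sum_inverse_nonpos[OF assms(3), of A] by simp
  moreover have "Im (of_real c * log_deriv \<gamma> ?A z) = 0"
    unfolding 1[symmetric] by simp
  ultimately show False using assms by simp
qed

lemma laguerre_step_no_nonpos_roots:
  fixes z :: real
  assumes "\<gamma> > 0" "c > 0" "\<forall>x\<in>#A. x > 0" "z \<le> 0"
  shows "poly (laguerre_step \<gamma> c (poly_of_roots A)) z \<noteq> 0"
proof (cases "z = 0")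
  case True
  have "0 \<notin># A" using assms(3) by auto
  then have "poly (poly_of_roots A) 0 \<noteq> 0" by (simp add: poly_of_roots_root_iff)
  with True assms show ?thesis by (simp add: laguerre_step_def)
next
  case False
  have nin: "z \<notin># A" using assms by force
  have "(\<Sum>x\<in>#A. 1 / (z - x)) \<le> 0"
    using assms(3)
  proof (induction A)
    case (add x A)
    then have "1 / (z - x) \<le> 0" using \<open>z \<le> 0\<close> by (simp add: divide_nonneg_neg)
    moreover have "(\<Sum>x\<in>#A. 1 / (z - x)) \<le> 0" using add by simp
    ultimately have "1 / (z - x) + (\<Sum>x\<in>#A. 1 / (z - x)) \<le> 0" by (rule add_nonpos_nonpos)
    then show ?case by simp
  qed simp
  moreover have "\<gamma> / z < 0" using False assms by (simp add: divide_pos_neg)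
  ultimately have "log_deriv \<gamma> A z < 0" by (simp add: log_deriv_def)
  then have "c * log_deriv \<gamma> A z < 0" using assms by (simp add: mult_pos_neg)
  then show ?thesis
    using False nin by (simp add: poly_laguerre_step_log_deriv poly_of_roots_root_iff)
qed

text \<open>Over \<open>\<complex>\<close> the polynomial splits. By complex conjugation the previous two lemmas exclude all zeros
  outside \<open>(0, \<infinity>)\<close>.\<close>
lemma laguerre_step_roots_positive:
  fixes A :: "real multiset"
  assumes "\<gamma> > 0" "c > 0" "\<forall>x\<in>#A. x > 0"
  shows "\<exists>A'. laguerre_step \<gamma> c (poly_of_roots A) = poly_of_roots A' \<and> size A' = Suc (size A)
    \<and> (\<forall>x\<in>#A'. x > 0)"
proof -
  define h where "h = laguerre_step \<gamma> c (poly_of_roots A)"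
  define hC where "hC = map_poly complex_of_real h"
  have hC: "hC = laguerre_step \<gamma> c (poly_of_roots (image_mset complex_of_real A))"
    by (simp add: hC_def h_def map_poly_laguerre_step map_poly_of_real_poly_of_roots)
  have deg: "degree h = Suc (size A)" and lead: "lead_coeff h = 1"
    unfolding h_def using degree_lead_coeff_laguerre_step[OF lead_coeff_poly_of_roots] by auto
  have degC: "degree hC = Suc (size A)"
    using deg by (simp add: hC_def degree_map_poly)
  have leadC: "lead_coeff hC = 1"
    unfolding degC using lead deg by (simp add: hC_def coeff_map_poly)
  have hC0: "hC \<noteq> 0" using leadC by auto
  have cnj: "poly hC (cnj z) = cnj (poly hC z)" for z
    unfolding hC_def by (induction h) (simp_all add: map_poly_pCons)
  have root_real: "Im z = 0" if "poly hC z = 0" for z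
  proof (rule ccontr)
    assume "Im z \<noteq> 0"
    then consider "Im z > 0" | "Im (cnj z) > 0" by force
    then show False
    proof cases
      case 1
      then show False
        using laguerre_step_no_upper_half_plane_roots[OF assms(1,2) 1] that by (simp add: hC)
    next
      case 2
      then show False
        using laguerre_step_no_upper_half_plane_roots[OF assms(1,2) 2] that cnj[of z] by (simp add: hC)
    qed
  qed
  define A' where "A' = image_mset Re (proots hC)"
  have real_roots: "image_mset complex_of_real A' = proots hC"
  proof -
    have "image_mset (\<lambda>z. complex_of_real (Re z)) (proots hC) = image_mset (\<lambda>z. z) (proots hC)"
      by (rule image_mset_cong) (use root_real hC0 in \<open>auto simp: complex_eq_iff\<close>)
    then show ?thesis by (simp add: A'_def multiset.map_comp comp_def)
  qed
  have "poly_of_roots (proots hC) = hC"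
    using complex_poly_decompose_multiset[of hC] leadC by (simp add: poly_of_roots_def)
  then have "map_poly complex_of_real (poly_of_roots A') = hC"
    by (simp add: map_poly_of_real_poly_of_roots real_roots)
  then have h_eq: "h = poly_of_roots A'"
    by (metis (no_types, lifting) hC_def coeff_map_poly of_real_0 of_real_eq_iff poly_eqI)
  moreover have "size A' = Suc (size A)"
    using deg h_eq by simp
  moreover have "x > 0" if "x \<in># A'" for x
  proof (rule ccontr)
    assume "\<not> x > 0"
    then have "poly h x \<noteq> 0"
      unfolding h_def by (intro laguerre_step_no_nonpos_roots assms) simp
    then show False using that by (simp add: h_eq poly_of_roots_root_iff)
  qed
  ultimately show ?thesis unfolding h_def by blast
qed

lemma log_deriv_has_derivative:
  fixes y :: real
  assumes "y \<noteq> 0" "y \<notin># A"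
  shows "(log_deriv \<gamma> A has_real_derivative - (\<gamma> / y\<^sup>2 + (\<Sum>x\<in>#A. 1 / (y - x)\<^sup>2))) (at y)"
proof -
  have "((\<lambda>y. \<Sum>x\<in>#A. 1 / (y - x)) has_real_derivative - (\<Sum>x\<in>#A. 1 / (y - x)\<^sup>2)) (at y)"
    using assms(2)
  proof (induction A)
    case (add x A)
    have "((\<lambda>y. 1 / (y - x)) has_real_derivative - (1 / (y - x)\<^sup>2)) (at y)"
      using add.prems by (auto intro!: derivative_eq_intros simp: power2_eq_square field_simps)
    then have "((\<lambda>y. 1 / (y - x) + (\<Sum>x\<in>#A. 1 / (y - x))) has_real_derivative
        - (1 / (y - x)\<^sup>2) + - (\<Sum>x\<in>#A. 1 / (y - x)\<^sup>2)) (at y)"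
      using add by (intro DERIV_add) auto
    then show ?case by simp
  qed simp
  moreover have "((\<lambda>y. \<gamma> / y) has_real_derivative - (\<gamma> / y\<^sup>2)) (at y)"
    using assms(1) by (auto intro!: derivative_eq_intros simp: power2_eq_square field_simps)
  ultimately have "((\<lambda>y. \<gamma> / y + (\<Sum>x\<in>#A. 1 / (y - x))) has_real_derivative
     - (\<gamma> / y\<^sup>2) + - (\<Sum>x\<in>#A. 1 / (y - x)\<^sup>2)) (at y)"
    by (rule DERIV_add[rotated])
  then show ?thesis by (simp add: log_deriv_def[abs_def])
qed

text \<open>Termwise this is \<open>1 / ((x - a) (y - a)) \<ge> 1 / (y - a)\<^sup>2\<close> multiplied by \<open>y - x\<close>: the function drops
  by at least the length of the step times its steepness at the right end.\<close>
lemma log_deriv_decrease: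
  fixes x y :: real
  assumes "0 < x" "x < y" "\<gamma> \<ge> 0" "\<forall>a\<in>#A. a < x"
  shows "log_deriv \<gamma> A y + (y - x) * (\<gamma> / y\<^sup>2 + (\<Sum>a\<in>#A. 1 / (y - a)\<^sup>2)) \<le> log_deriv \<gamma> A x"
proof -
  have one: "1 / (y - a) + (y - x) * (1 / (y - a)\<^sup>2) \<le> 1 / (x - a)" if "a < x" for a
  proof -
    have "1 / (x - a) - 1 / (y - a) - (y - x) * (1 / (y - a)\<^sup>2)
        = (y - x)\<^sup>2 / ((x - a) * (y - a)\<^sup>2)"
      using that assms by (simp add: divide_simps power2_eq_square) (simp add: algebra_simps)
    moreover have "(y - x)\<^sup>2 / ((x - a) * (y - a)\<^sup>2) \<ge> 0" using that by simp
    ultimately show ?thesis by linarith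
  qed
  have "(\<Sum>a\<in>#A. 1 / (y - a)) + (y - x) * (\<Sum>a\<in>#A. 1 / (y - a)\<^sup>2) \<le> (\<Sum>a\<in>#A. 1 / (x - a))"
    using assms(4)
  proof (induction A)
    case (add a A)
    then show ?case using one[of a] by (simp add: algebra_simps)
  qed simp
  moreover have "\<gamma> / y + (y - x) * (\<gamma> / y\<^sup>2) \<le> \<gamma> / x"
    using mult_left_mono[OF one[of 0] assms(3)] assms by (simp add: algebra_simps)
  ultimately show ?thesis by (simp add: log_deriv_def algebra_simps)
qed

text \<open>The barrier argument of Marcus, Spielman and Srivastava. Let \<open>u\<close> be the logarithmic derivative
  for \<open>f\<close>. That for \<open>f - c f' = f (1 - c u)\<close> is \<open>u - c u' / (1 - c u)\<close>. Passing to
  \<open>f - c f'\<close> raises \<open>u\<close> at \<open>y\<close> by \<open>c / (1 - c u) \<le> 2 c \<le> 1 / \<phi>\<close> times \<open>- u'(y)\<close>, and moving from \<open>x\<close> to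
  \<open>y = x + 1 / \<phi>\<close> lowers it by at least as much. So one step costs a shift of \<open>1 / \<phi>\<close> of the
  point at which the bound \<open>\<phi>\<close> is kept.\<close>
lemma laguerre_step_barrier:
  fixes x \<phi> :: real
  assumes \<gamma>: "\<gamma> > 0" and c: "c > 0" and \<phi>: "0 < \<phi>" "2 * c * \<phi> \<le> 1"
    and x: "0 < x" "\<forall>a\<in>#A. a < x" and bound: "log_deriv \<gamma> A x \<le> \<phi>"
    and step: "laguerre_step \<gamma> c (poly_of_roots A) = poly_of_roots A'"
  shows "\<forall>a\<in>#A'. a < x + 1 / \<phi>" "log_deriv (\<gamma> - 1) A' (x + 1 / \<phi>) \<le> \<phi>"
proof -
  have mono: "log_deriv \<gamma> A y \<le> \<phi>" if "y \<ge> x" for y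
  proof (cases "y = x")
    case False
    then have "log_deriv \<gamma> A y + (y - x) * (\<gamma> / y\<^sup>2 + (\<Sum>a\<in>#A. 1 / (y - a)\<^sup>2)) \<le> log_deriv \<gamma> A x"
      using that \<gamma> x by (intro log_deriv_decrease) auto
    moreover have "(\<Sum>a\<in>#A. 1 / (y - a)\<^sup>2) \<ge> 0"
      by (induction A) simp_all
    then have "(y - x) * (\<gamma> / y\<^sup>2 + (\<Sum>a\<in>#A. 1 / (y - a)\<^sup>2)) \<ge> 0"
      using that \<gamma> by simp
    ultimately show ?thesis using bound by linarith
  qed (use bound in simp)
  \<comment> \<open>To the right of \<open>x\<close> the factor \<open>1 - c u\<close> stays positive, so no zero appears there.\<close>
  have half: "1 - c * log_deriv \<gamma> A y \<ge> 1 / 2" if "y \<ge> x" for y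
  proof -
    have "c * log_deriv \<gamma> A y \<le> c * \<phi>"
      using c by (intro mult_left_mono mono that) simp
    then show ?thesis using \<phi> by simp
  qed
  have no_root: "poly (poly_of_roots A') y \<noteq> 0" if "y \<ge> x" for y
  proof -
    have "y \<noteq> 0" "y \<notin># A" using that x by auto
    then show ?thesis
      using half[OF that] by (auto simp flip: step simp: poly_laguerre_step_log_deriv poly_of_roots_root_iff)
  qed
  have below: "a < x" if "a \<in># A'" for a
    using no_root[of a] that by (force simp: poly_of_roots_root_iff)
  define y where "y = x + 1 / \<phi>"
  have y: "y > x" using \<phi> by (simp add: y_def)
  show "\<forall>a\<in>#A'. a < x + 1 / \<phi>" 
  proof
    fix a assume "a \<in># A'"
    from below[OF this] y show "a < x + 1 / \<phi>" unfolding y_def by linarith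
  qed
  define S where "S = \<gamma> / y\<^sup>2 + (\<Sum>a\<in>#A. 1 / (y - a)\<^sup>2)"
  define u where "u = log_deriv \<gamma> A y"
  define p where "p = poly (poly_of_roots A) y"
  have yA: "y \<noteq> 0" "y \<notin># A" "y \<notin># A'" using y x below by force+
  have S0: "S \<ge> 0"
  proof -
    have "(\<Sum>a\<in>#A. 1 / (y - a)\<^sup>2) \<ge> 0" by (induction A) simp_all
    then show ?thesis using \<gamma> by (simp add: S_def)
  qed
  have p0: "p \<noteq> 0" using yA by (simp add: p_def poly_of_roots_root_iff)
  have u_half: "1 - c * u \<ge> 1 / 2" using half[of y] y by (simp add: u_def)
  have "((\<lambda>t. t * poly (poly_of_roots A) t * (1 - c * log_deriv \<gamma> A t)) has_real_derivative
      (p + y * (p * (\<Sum>a\<in>#A. 1 / (y - a)))) * (1 - c * u) + y * p * (c * S)) (at y)"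
    using yA
    by (auto intro!: derivative_eq_intros log_deriv_has_derivative
        simp: poly_pderiv_poly_of_roots u_def p_def S_def) (simp add: algebra_simps)
  moreover have "\<forall>\<^sub>F t in nhds y. t * poly (poly_of_roots A) t * (1 - c * log_deriv \<gamma> A t)
      = poly (poly_of_roots A') t"
  proof -
    have "\<forall>\<^sub>F t in nhds y. t > x" using y by (rule order_tendstoD(1)[OF filterlim_ident])
    then show ?thesis
    proof eventually_elim
      case (elim t)
      then have "t \<noteq> 0" "t \<notin># A" using x by auto
      then show ?case by (simp flip: step add: poly_laguerre_step_log_deriv)
    qed
  qed
  ultimately have "(poly (poly_of_roots A') has_real_derivative
      (p + y * (p * (\<Sum>a\<in>#A. 1 / (y - a)))) * (1 - c * u) + y * p * (c * S)) (at y)"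
    by (simp add: DERIV_cong_ev[OF refl _ refl])
  then have "poly (pderiv (poly_of_roots A')) y
      = (p + y * (p * (\<Sum>a\<in>#A. 1 / (y - a)))) * (1 - c * u) + y * p * (c * S)"
    using poly_DERIV DERIV_unique by blast
  moreover have "poly (poly_of_roots A') y = y * p * (1 - c * u)"
    using yA by (simp flip: step add: poly_laguerre_step_log_deriv p_def u_def)
  ultimately have "y * p * (1 - c * u) * (\<Sum>a\<in>#A'. 1 / (y - a))
     = (p + y * (p * (\<Sum>a\<in>#A. 1 / (y - a)))) * (1 - c * u) + y * p * (c * S)"
    using poly_pderiv_poly_of_roots[OF yA(3)] by simp
  then have "(\<Sum>a\<in>#A'. 1 / (y - a)) = 1 / y + (\<Sum>a\<in>#A. 1 / (y - a)) + c * S / (1 - c * u)"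
  proof -
    define v where "v = 1 - c * u"
    have nz: "v \<noteq> 0" "y * p * v \<noteq> 0" using p0 yA u_half by (auto simp: v_def)
    then have "y * p * v * (1 / y + (\<Sum>a\<in>#A. 1 / (y - a)) + c * S / v)
        = (p + y * (p * (\<Sum>a\<in>#A. 1 / (y - a)))) * v + y * p * (c * S)"
      by (simp add: field_simps)
    with \<open>y * p * (1 - c * u) * (\<Sum>a\<in>#A'. 1 / (y - a)) = _\<close>
    have "y * p * v * (\<Sum>a\<in>#A'. 1 / (y - a))
        = y * p * v * (1 / y + (\<Sum>a\<in>#A. 1 / (y - a)) + c * S / v)"
      unfolding v_def by simp
    then show ?thesis using nz(2) unfolding v_def by (metis mult_left_cancel)
  qed
  then have "log_deriv (\<gamma> - 1) A' y = u + c * S / (1 - c * u)"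
    by (simp add: log_deriv_def u_def diff_divide_distrib)
  also have "c * S / (1 - c * u) \<le> c * S / (1 / 2)"
    using u_half S0 c by (intro divide_left_mono) auto
  also have "\<dots> \<le> (y - x) * S"
  proof -
    have "2 * c \<le> 1 / \<phi>" using \<phi> by (simp add: field_simps)
    then show ?thesis using S0 mult_right_mono[of "2 * c" "1 / \<phi>" S] by (simp add: y_def mult_ac)
  qed
  also have "u + (y - x) * S \<le> log_deriv \<gamma> A x"
    unfolding u_def S_def using y x \<gamma> by (intro log_deriv_decrease) auto
  finally show "log_deriv (\<gamma> - 1) A' (x + 1 / \<phi>) \<le> \<phi>"
    using bound by (simp add: y_def)
qed

text \<open>\<open>x\<^bsup>- \<beta>\<^esup> \<Prod>(1 - c d/dx) x\<^sup>M\<close> with \<open>\<beta> = M - length cs\<close>, the product running over the list. It is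
  the Rodrigues formula, since \<open>1 - c d/dx\<close> is \<open>- c e\<^bsup>x / c\<^esup> d/dx e\<^bsup>- x / c\<^esup>\<close>.\<close>
fun laguerre_poly :: "real \<Rightarrow> real list \<Rightarrow> real poly" where
  "laguerre_poly M [] = 1"
| "laguerre_poly M (c # cs) = laguerre_step (M - real (length cs)) c (laguerre_poly M cs)"

lemma degree_lead_coeff_laguerre_poly:
  "degree (laguerre_poly M cs) = length cs \<and> lead_coeff (laguerre_poly M cs) = 1"
proof (induction cs)
  case (Cons c cs)
  then show ?case
    using degree_lead_coeff_laguerre_step[of "laguerre_poly M cs" "M - real (length cs)" c]
    by (metis laguerre_poly.simps(2) length_Cons)
qed simp

text \<open>For \<open>x\<^sup>M\<close> the logarithmic derivative \<open>M / x\<close> equals \<open>1 / (2 cmax)\<close> at \<open>x = 2 cmax M\<close>; from there each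
  factor moves the barrier by \<open>2 cmax\<close>. When all \<open>c\<close> are of order \<open>1 / N\<close> and \<open>M\<close> is of order \<open>N\<close>, the
  resulting bound on the zeros does not depend on \<open>N\<close>.\<close>
theorem laguerre_poly_roots:
  assumes "M > 0" "real (length cs) \<le> M" "\<forall>c\<in>set cs. 0 < c \<and> c \<le> cmax" "cmax > 0"
  shows "\<exists>A. laguerre_poly M cs = poly_of_roots A \<and> size A = length cs \<and>
    (\<forall>x\<in>#A. 0 < x \<and> x < 2 * cmax * (M + real (length cs))) \<and>
    log_deriv (M - real (length cs)) A (2 * cmax * (M + real (length cs))) \<le> 1 / (2 * cmax)"
  using assms(2,3)
proof (induction cs)
  case Nil
  have "M / (2 * cmax * M) = 1 / (2 * cmax)" using assms by simp
  then show ?case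
    by (intro exI[of _ "{#}"]) (simp add: log_deriv_def)
next
  case (Cons c cs)
  define m where "m = real (length cs)"
  define X where "X = 2 * cmax * (M + m)"
  from Cons obtain A where A: "laguerre_poly M cs = poly_of_roots A" "size A = length cs"
    "\<forall>x\<in>#A. 0 < x \<and> x < X" "log_deriv (M - m) A X \<le> 1 / (2 * cmax)"
    by (auto simp: X_def m_def)
  have c: "0 < c" "c \<le> cmax" and M: "M - m > 0" and X: "X > 0"
    using Cons.prems assms by (auto simp: m_def X_def)
  obtain A' where A': "laguerre_step (M - m) c (poly_of_roots A) = poly_of_roots A'"
    "size A' = Suc (size A)" "\<forall>x\<in>#A'. x > 0"
    using laguerre_step_roots_positive[OF M c(1), of A] A(3) by auto
  have *: "2 * c * (1 / (2 * cmax)) \<le> 1" "0 < 1 / (2 * cmax)"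
    using c assms by (simp_all add: field_simps)
  have X': "X + 1 / (1 / (2 * cmax)) = 2 * cmax * (M + real (length (c # cs)))"
    by (simp add: X_def m_def algebra_simps)
  have M': "M - m - 1 = M - real (length (c # cs))" by (simp add: m_def)
  have "\<forall>a\<in>#A. a < X" using A(3) by blast
  note barrier = laguerre_step_barrier[OF M c(1) *(2,1) X this A(4) A'(1), unfolded X' M']
  have "laguerre_poly M (c # cs) = poly_of_roots A'"
    using A(1) A'(1) by (simp add: m_def)
  moreover have "size A' = length (c # cs)" using A(2) A'(2) by simp
  ultimately show ?case using A'(3) barrier by blast
qed

section \<open>Orthogonality and the explicit formula\<close>

lemma gamma_integral_scaled:
  fixes b s :: real
  assumes "b > 0" "s > 0"
  shows "has_bochner_integral lborel (\<lambda>x. indicator {0..} x * (x powr (s - 1) * exp (- b * x)))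
    (Gamma s / b powr s)"
proof (rule has_bochner_integral_nn_integral)
  have eq: "ennreal (indicator {0..} (b * x) * (b * x) powr (s - 1) / exp (b * x))
     = ennreal (b powr (s - 1)) * ennreal (indicator {0..} x * (x powr (s - 1) * exp (- b * x)))" for x
  proof (cases "x \<ge> 0")
    case True
    then show ?thesis
      using assms by (simp add: powr_mult exp_minus field_simps flip: ennreal_mult')
  next
    case False
    then have "\<not> b * x \<ge> 0" using assms by (simp add: zero_le_mult_iff)
    with False show ?thesis by simp
  qed
  have "ennreal (Gamma s)
      = (\<integral>\<^sup>+x. ennreal (indicator {0..} x * x powr (s - 1) / exp x) \<partial>lborel)"
    by (rule Gamma_conv_nn_integral_real) fact
  also have "\<dots> = ennreal b *
      (\<integral>\<^sup>+x. ennreal (indicator {0..} (b * x) * (b * x) powr (s - 1) / exp (b * x)) \<partial>lborel)"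
    using assms by (subst nn_integral_real_affine[where c = b and t = 0]) auto
  also have "\<dots> = ennreal b * (ennreal (b powr (s - 1)) *
      (\<integral>\<^sup>+x. ennreal (indicator {0..} x * (x powr (s - 1) * exp (- b * x))) \<partial>lborel))"
    unfolding eq by (subst nn_integral_cmult) auto
  also have "\<dots> = ennreal (b powr s) *
      (\<integral>\<^sup>+x. ennreal (indicator {0..} x * (x powr (s - 1) * exp (- b * x))) \<partial>lborel)"
    using assms by (simp add: powr_diff mult.assoc[symmetric] flip: ennreal_mult')
  finally have *: "ennreal (Gamma s) = ennreal (b powr s) *
      (\<integral>\<^sup>+x. ennreal (indicator {0..} x * (x powr (s - 1) * exp (- b * x))) \<partial>lborel)" .
  have "ennreal (Gamma s / b powr s) = ennreal (1 / b powr s) * ennreal (Gamma s)"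
    using assms by (simp flip: ennreal_mult')
  also have "\<dots> = ennreal (1 / b powr s) * ennreal (b powr s) *
      (\<integral>\<^sup>+x. ennreal (indicator {0..} x * (x powr (s - 1) * exp (- b * x))) \<partial>lborel)"
    unfolding * by (simp add: mult.assoc)
  also have "ennreal (1 / b powr s) * ennreal (b powr s) = 1"
    using assms by (simp flip: ennreal_mult')
  finally show "(\<integral>\<^sup>+x. ennreal (indicator {0..} x * (x powr (s - 1) * exp (- b * x))) \<partial>lborel)
    = ennreal (Gamma s / b powr s)" by simp
qed (use assms in \<open>auto intro!: AE_I2 simp: Gamma_real_pos less_imp_le\<close>)

text \<open>\<open>(t + k - 1 + \<theta>) \<dots> (t + 1 + \<theta>) (t + \<theta>) R\<close> for the Euler operator \<open>\<theta> = x d/dx\<close>.\<close>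
fun euler_iterate :: "nat \<Rightarrow> real \<Rightarrow> real poly \<Rightarrow> real poly" where
  "euler_iterate 0 t R = R"
| "euler_iterate (Suc k) t R = euler_iterate k (t + 1) (smult t R + pCons 0 (pderiv R))"

lemma coeff_euler_iterate:
  "coeff (euler_iterate k t R) m = coeff R m * pochhammer (t + real m) k"
proof (induction k arbitrary: t R)
  case (Suc k)
  have "coeff (smult t R + pCons 0 (pderiv R)) m = (t + real m) * coeff R m"
    by (cases m) (simp_all add: coeff_pderiv algebra_simps)
  then show ?case
    by (simp add: Suc pochhammer_rec algebra_simps)
qed simp

text \<open>At a zero \<open>c \<noteq> 0\<close> of \<open>R\<close> the operator \<open>t + x d/dx\<close> lowers the multiplicity by exactly one.\<close>
lemma euler_step_order:
  fixes R :: "real poly"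
  assumes "c \<noteq> 0" "poly R c = 0"
  shows "[:- c, 1:] ^ n dvd smult t R + pCons 0 (pderiv R) \<longleftrightarrow> [:- c, 1:] ^ Suc n dvd R"
proof (cases "R = 0")
  case False
  then obtain m where m: "order c R = Suc m"
    using assms(2) order_root[of R c] by (metis not0_implies_Suc)
  then obtain S where S: "R = [:- c, 1:] ^ Suc m * S" "\<not> [:- c, 1:] dvd S"
    using order_decomp[OF False, of c] by auto
  define L where "L = [:- c, 1:]"
  define U where "U = smult t (L * S) + [:0, 1:] * (smult (real (Suc m)) S + L * pderiv S)"
  have p1: "pderiv L = 1" by (simp add: L_def pderiv_pCons)
  have "smult t R + pCons 0 (pderiv R) = L ^ m * U"
  proof -
    have "pderiv R = L ^ m * (smult (real (Suc m)) S + L * pderiv S)"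
      unfolding S(1) pderiv_mult L_def[symmetric] pderiv_power_Suc p1
      by (simp only: power_Suc mult_smult_right mult_smult_left distrib_left mult_1_right mult_1_left ac_simps)
    then have "pCons 0 (pderiv R)
        = [:0, 1:] * (L ^ m * (smult (real (Suc m)) S + L * pderiv S))" by simp
    moreover have "smult t R = smult t (L ^ m * (L * S))"
      by (simp only: S(1) L_def power_Suc mult_ac)
    ultimately show ?thesis
      unfolding U_def by (simp only: mult_smult_right distrib_left mult.left_commute)
  qed
  moreover have "poly U c \<noteq> 0"
    using S(2) assms(1) by (simp add: U_def L_def poly_eq_0_iff_dvd)
  then have U0: "U \<noteq> 0" "order c U = 0" by (auto simp: order_0I)
  ultimately have "smult t R + pCons 0 (pderiv R) \<noteq> 0" "order c (smult t R + pCons 0 (pderiv R)) = m"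
    by (simp_all add: L_def order_mult order_power_n_n)
  then show ?thesis using False m by (simp add: order_divides del: power_Suc)
qed simp

lemma euler_iterate_vanish_iff:
  assumes "c \<noteq> 0"
  shows "(\<forall>k<n. poly (euler_iterate k t R) c = 0) \<longleftrightarrow> [:- c, 1:] ^ n dvd R"
proof (induction n arbitrary: t R)
  case (Suc n)
  have "(\<forall>k<Suc n. poly (euler_iterate k t R) c = 0) \<longleftrightarrow>
      poly R c = 0 \<and> (\<forall>k<n. poly (euler_iterate k (t + 1) (smult t R + pCons 0 (pderiv R))) c = 0)"
    by (auto simp: less_Suc_eq_0_disj)
  also have "\<dots> \<longleftrightarrow> poly R c = 0 \<and> [:- c, 1:] ^ Suc n dvd R"
    using Suc euler_step_order[OF assms] by blast
  also have "\<dots> \<longleftrightarrow> [:- c, 1:] ^ Suc n dvd R"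
    by (metis dvd_mult_left poly_eq_0_iff_dvd power_Suc)
  finally show ?case .
qed simp

text \<open>If \<open>R\<close> denotes this polynomial, then \<open>s\<^bsup>- \<beta> - 1\<^esup> R(1 / s)\<close> is the Laplace transform of \<open>x\<^sup>\<beta> P(x)\<close>.\<close>
definition gamma_poly :: "real \<Rightarrow> real poly \<Rightarrow> real poly" where
  "gamma_poly \<beta> P = (\<Sum>m\<le>degree P. monom (coeff P m * Gamma (\<beta> + 1 + real m)) m)"

lemma coeff_gamma_poly: "coeff (gamma_poly \<beta> P) m = coeff P m * Gamma (\<beta> + 1 + real m)"
  by (auto simp: gamma_poly_def coeff_sum coeff_eq_0 if_distrib sum.delta cong: if_cong)

lemma Gamma_shift_pos: "\<beta> \<ge> 0 \<Longrightarrow> Gamma (\<beta> + 1 + real m) > 0"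
  by (intro Gamma_real_pos) simp

lemma degree_gamma_poly: "\<beta> \<ge> 0 \<Longrightarrow> degree (gamma_poly \<beta> P) = degree P"
  using Gamma_shift_pos[of \<beta>] by (simp add: degree_def coeff_gamma_poly less_imp_neq[symmetric])

text \<open>The integral is, up to sign, the \<open>k\<close>-th derivative at \<open>b\<close> of the Laplace transform of \<open>x\<^sup>\<beta> P(x)\<close>, written in the
  variable \<open>1 / b\<close>.\<close>
lemma laguerre_orthogonality_integral:
  fixes P :: "real poly"
  assumes "b > 0" "\<beta> \<ge> 0"
  shows "(LBINT x:{0..}. x ^ k * poly P x * exp ((1 - b) * x) * (x powr \<beta> * exp (- x)))
    = poly (euler_iterate k (\<beta> + 1) (gamma_poly \<beta> P)) (1 / b) / b powr (\<beta> + 1 + real k)"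
proof -
  define s where "s m = \<beta> + 1 + real m + real k" for m
  have s: "s m > 0" for m using assms by (simp add: s_def add_nonneg_pos add_pos_nonneg)
  have eq: "indicator {0..} x *\<^sub>R (x ^ k * poly P x * exp ((1 - b) * x) * (x powr \<beta> * exp (- x)))
      = (\<Sum>m\<le>degree P. coeff P m * (indicator {0..} x * (x powr (s m - 1) * exp (- b * x))))" for x :: real
  proof (cases "x \<ge> 0")
    case True
    \<comment> \<open>At \<open>x = 0\<close> both sides vanish, since \<open>0 powr \<beta> = 0\<close> even for \<open>\<beta> = 0\<close>.\<close>
    have pw: "x powr (s m - 1) = x ^ k * x ^ m * x powr \<beta>" for m
    proof (cases "x = 0")
      case False
      then have "x powr (s m - 1) = x powr (real k + real m + \<beta>)" by (simp add: s_def add_ac)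
      also have "\<dots> = x ^ k * x ^ m * x powr \<beta>"
        using True False by (simp add: powr_add powr_realpow)
      finally show ?thesis .
    qed simp
    have "exp ((1 - b) * x) * exp (- x) = exp (- b * x)"
      by (simp add: algebra_simps flip: exp_add)
    then have "x ^ k * poly P x * exp ((1 - b) * x) * (x powr \<beta> * exp (- x))
        = (\<Sum>m\<le>degree P. coeff P m * x ^ m) * (x ^ k * x powr \<beta> * exp (- b * x))"
      by (simp only: poly_altdef mult.assoc mult.left_commute[of _ "x powr \<beta>"]) (simp only: mult_ac)
    also have "\<dots> = (\<Sum>m\<le>degree P. coeff P m * (x powr (s m - 1) * exp (- b * x)))"
      by (simp only: sum_distrib_right pw) (simp add: mult_ac)
    finally show ?thesis using True by simp
  qed simp
  have "has_bochner_integral lborel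
      (\<lambda>x. \<Sum>m\<le>degree P. coeff P m * (indicator {0..} x * (x powr (s m - 1) * exp (- b * x))))
      (\<Sum>m\<le>degree P. coeff P m * (Gamma (s m) / b powr (s m)))"
    by (intro has_bochner_integral_sum has_bochner_integral_mult_right gamma_integral_scaled assms s)
  then have "(LBINT x:{0..}. x ^ k * poly P x * exp ((1 - b) * x) * (x powr \<beta> * exp (- x)))
      = (\<Sum>m\<le>degree P. coeff P m * (Gamma (s m) / b powr (s m)))"
    unfolding set_lebesgue_integral_def eq by (rule has_bochner_integral_integral_eq)
  also have "\<dots> = (\<Sum>m\<le>degree P. coeff (euler_iterate k (\<beta> + 1) (gamma_poly \<beta> P)) m * (1 / b) ^ m
      / b powr (\<beta> + 1 + real k))"
  proof (rule sum.cong)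
    fix m
    have "\<beta> + 1 + real m \<notin> \<int>\<^sub>\<le>\<^sub>0" using assms by (auto elim!: nonpos_Ints_cases)
    then have "Gamma (s m) = Gamma (\<beta> + 1 + real m) * pochhammer (\<beta> + 1 + real m) k"
      using Gamma_shift_pos[OF assms(2), of m] by (simp add: pochhammer_Gamma s_def)
    moreover have "b powr (s m) = b ^ m * b powr (\<beta> + 1 + real k)"
      using assms by (simp add: s_def powr_add powr_realpow)
    ultimately show "coeff P m * (Gamma (s m) / b powr (s m))
       = coeff (euler_iterate k (\<beta> + 1) (gamma_poly \<beta> P)) m * (1 / b) ^ m / b powr (\<beta> + 1 + real k)"
      by (simp add: coeff_euler_iterate coeff_gamma_poly power_divide mult_ac)
  qed simp
  also have "\<dots> = poly (euler_iterate k (\<beta> + 1) (gamma_poly \<beta> P)) (1 / b) / b powr (\<beta> + 1 + real k)"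
  proof -
    have "degree (euler_iterate k (\<beta> + 1) (gamma_poly \<beta> P)) \<le> degree P"
      by (rule degree_le) (simp add: coeff_euler_iterate coeff_gamma_poly coeff_eq_0)
    then have "poly (euler_iterate k (\<beta> + 1) (gamma_poly \<beta> P)) (1 / b)
      = (\<Sum>m\<le>degree P. coeff (euler_iterate k (\<beta> + 1) (gamma_poly \<beta> P)) m * (1 / b) ^ m)"
      unfolding poly_altdef by (intro sum.mono_neutral_left) (auto simp: coeff_eq_0)
    then show ?thesis by (simp add: sum_divide_distrib)
  qed
  finally show ?thesis .
qed

lemma prod_linear_powers_dvd:
  fixes R :: "real poly"
  assumes "finite J" "inj_on c J" "\<And>j. j \<in> J \<Longrightarrow> [:- c j, 1:] ^ n j dvd R"
  shows "(\<Prod>j\<in>J. [:- c j, 1:] ^ n j) dvd R"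
  using assms
proof (induction J)
  case (insert j J)
  define A where "A = (\<Prod>i\<in>J. [:- c i, 1:] ^ n i)"
  have "A dvd R" using insert by (simp add: A_def)
  then obtain K where K: "R = A * K" by (elim dvdE)
  have "poly A (c j) \<noteq> 0"
    using insert.hyps insert.prems(1) by (auto simp: A_def poly_prod prod_zero_iff inj_on_def)
  then have "A \<noteq> 0" "order (c j) A = 0" by (auto simp: order_0I)
  then have "[:- c j, 1:] ^ n j dvd K"
    using insert.prems(2)[of j] by (cases "K = 0") (simp_all add: K order_divides order_mult)
  then have "A * [:- c j, 1:] ^ n j dvd A * K" by (rule mult_dvd_mono[OF dvd_refl])
  then show ?case
    unfolding prod.insert[OF insert.hyps] K A_def by (simp only: mult.commute)
qed simp

lemma Gamma_falling_factorial:
  assumes "\<beta> \<ge> 0"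
  shows "falling_factorial (\<beta> + real (m + k)) k * Gamma (\<beta> + 1 + real m) = Gamma (\<beta> + 1 + real (m + k))"
proof (induction k)
  case (Suc k)
  have shift: "falling_factorial (x + 1) (Suc k) = (x + 1) * falling_factorial x k" for x k
    by (simp add: falling_factorial_def prod.lessThan_Suc_shift del: prod.lessThan_Suc)
  have "\<beta> + 1 + real (m + k) \<notin> \<int>\<^sub>\<le>\<^sub>0"
    using assms by (auto dest!: nonpos_Ints_nonpos)
  then have "Gamma (\<beta> + 1 + real (m + k) + 1) = (\<beta> + 1 + real (m + k)) * Gamma (\<beta> + 1 + real (m + k))"
    by (rule Gamma_plus1)
  moreover have "falling_factorial (\<beta> + real (m + Suc k)) (Suc k)
      = (\<beta> + 1 + real (m + k)) * falling_factorial (\<beta> + real (m + k)) k"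
    using shift[of "\<beta> + real (m + k)" k] by (simp add: add_ac)
  ultimately show ?case using Suc by (simp add: add_ac mult.assoc)
qed simp

text \<open>The coefficient of \<open>x\<^sup>l\<close> comes from differentiating \<open>x\<^sup>M\<close> exactly \<open>length cs - l\<close> times.\<close>
lemma coeff_laguerre_poly:
  assumes "l \<le> length cs"
  shows "coeff (laguerre_poly M cs) l
    = coeff (\<Prod>c\<leftarrow>cs. [:- c, 1:]) l * falling_factorial M (length cs - l)"
  using assms
proof (induction cs arbitrary: l)
  case (Cons c cs)
  define p where "p = (\<Prod>c\<leftarrow>cs. [:- c, 1:])"
  have IH: "coeff (laguerre_poly M cs) l = coeff p l * falling_factorial M (length cs - l)"
    if "l \<le> length cs" for l
    using Cons.IH[OF that] by (simp add: p_def)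
  show ?case
  proof (cases l)
    case 0
    have "coeff (laguerre_poly M (c # cs)) 0 = - c * (M - real (length cs)) * coeff (laguerre_poly M cs) 0"
      by (simp add: laguerre_step_def)
    then show ?thesis
      using IH[of 0] by (simp add: 0 falling_factorial_Suc flip: p_def)
  next
    case (Suc j)
    then have j: "j \<le> length cs" using Cons.prems by simp
    have "degree p \<le> length cs"
      unfolding p_def
    proof (induction cs)
      case (Cons c cs)
      have "degree ([:- c, 1:] * (\<Prod>c\<leftarrow>cs. [:- c, 1:])) \<le> 1 + degree (\<Prod>c\<leftarrow>cs. [:- c, 1:])"
        by (rule order_trans[OF degree_mult_le]) simp
      with Cons show ?case by (simp del: mult_pCons_left)
    qed simp
    moreover have "degree (laguerre_poly M cs) = length cs"
      using degree_lead_coeff_laguerre_poly by blast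
    ultimately have deg: "degree p < Suc j" "degree (laguerre_poly M cs) < Suc j" if "length cs < Suc j"
      using that by simp_all
    have "coeff (laguerre_poly M (c # cs)) (Suc j) = coeff (laguerre_poly M cs) j
        - c * (coeff (laguerre_poly M cs) (Suc j) * (M - real (length cs) + real (Suc j)))"
      by (simp add: coeff_laguerre_step_Suc)
    moreover have "coeff (laguerre_poly M cs) (Suc j) * (M - real (length cs) + real (Suc j))
        = coeff p (Suc j) * falling_factorial M (length cs - j)"
    proof (cases "Suc j \<le> length cs")
      case True
      then have "length cs - j = Suc (length cs - Suc j)" by simp
      moreover have "M - real (length cs - Suc j) = M - real (length cs) + real (Suc j)"
        using True by (simp add: of_nat_diff)
      ultimately show ?thesis
        using IH[OF True] by (simp add: falling_factorial_Suc del: of_nat_Suc)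
    next
      case False
      then show ?thesis using deg by (simp add: coeff_eq_0)
    qed
    ultimately have "coeff (laguerre_poly M (c # cs)) (Suc j)
        = (coeff p j - c * coeff p (Suc j)) * falling_factorial M (length cs - j)"
      by (simp only: IH[OF j]) (simp add: algebra_simps)
    then show ?thesis
      by (simp add: Suc p_def del: laguerre_poly.simps)
  qed
qed simp

text \<open>By the Laplace transform, orthogonality means that the \<open>gamma_poly\<close> of \<open>P\<close> vanishes at each \<open>1 / b\<^sub>j\<close> to order
  \<open>n\<^sub>j\<close>. These are as many zeros as its degree allows, so it is determined up to the constant fixed by
  the leading coefficient. Existence and uniqueness are both contained in this.\<close>
theorem is_multiple_laguerre2_iff:
  fixes r :: nat and n :: "nat \<Rightarrow> nat" and \<beta> :: real and b :: "nat \<Rightarrow> real"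
  assumes b: "\<And>j. j \<in> {1..r} \<Longrightarrow> b j > 0" "inj_on b {1..r}" and \<beta>: "\<beta> \<ge> 0"
  defines "N \<equiv> (\<Sum>i=1..r. n i)" and "D \<equiv> (\<Prod>j=1..r. [:- (1 / b j), 1:] ^ n j)"
  shows "is_multiple_laguerre2 r n \<beta> b P \<longleftrightarrow> gamma_poly \<beta> P = smult (Gamma (\<beta> + 1 + real N)) D"
proof -
  have deg_D: "degree D = N"
    unfolding D_def N_def by (subst degree_prod_sum_eq) (auto simp: degree_power_eq)
  have lead_D: "lead_coeff D = 1"
    by (simp add: D_def lead_coeff_prod lead_coeff_power)
  have orth: "(\<forall>k<n j. (LBINT x:{0..}. x ^ k * poly P x * exp ((1 - b j) * x) * (x powr \<beta> * exp (- x))) = 0)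
      \<longleftrightarrow> [:- (1 / b j), 1:] ^ n j dvd gamma_poly \<beta> P" if "j \<in> {1..r}" for j
  proof -
    have "b j > 0" using b(1) that .
    then show ?thesis
      using euler_iterate_vanish_iff[of "1 / b j" "n j" "\<beta> + 1" "gamma_poly \<beta> P"]
      by (simp add: laguerre_orthogonality_integral \<beta>)
  qed
  have inj: "inj_on (\<lambda>j. 1 / b j) {1..r}"
  proof (rule inj_onI)
    fix i j assume "i \<in> {1..r}" "j \<in> {1..r}" "1 / b i = 1 / b j"
    then show "i = j" using inj_onD[OF b(2), of i j] by simp
  qed
  have G: "Gamma (\<beta> + 1 + real N) > 0" by (rule Gamma_shift_pos[OF \<beta>])
  have "is_multiple_laguerre2 r n \<beta> b P \<longleftrightarrow> lead_coeff P = 1 \<and> degree P = N \<and>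
      (\<forall>j\<in>{1..r}. [:- (1 / b j), 1:] ^ n j dvd gamma_poly \<beta> P)"
    unfolding is_multiple_laguerre2_def N_def using orth by (intro conj_cong ball_cong refl)
  also have "\<dots> \<longleftrightarrow> lead_coeff P = 1 \<and> degree P = N \<and> D dvd gamma_poly \<beta> P"
  proof -
    have "(\<forall>j\<in>{1..r}. [:- (1 / b j), 1:] ^ n j dvd gamma_poly \<beta> P) \<longleftrightarrow> D dvd gamma_poly \<beta> P"
    proof
      assume "\<forall>j\<in>{1..r}. [:- (1 / b j), 1:] ^ n j dvd gamma_poly \<beta> P"
      then show "D dvd gamma_poly \<beta> P"
        unfolding D_def using inj by (intro prod_linear_powers_dvd) auto
    next
      assume "D dvd gamma_poly \<beta> P"
      moreover have "[:- (1 / b j), 1:] ^ n j dvd D" if "j \<in> {1..r}" for j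
        unfolding D_def using that by (intro dvd_prodI) auto
      ultimately show "\<forall>j\<in>{1..r}. [:- (1 / b j), 1:] ^ n j dvd gamma_poly \<beta> P"
        by (blast intro: dvd_trans)
    qed
    then show ?thesis by blast
  qed
  also have "\<dots> \<longleftrightarrow> gamma_poly \<beta> P = smult (Gamma (\<beta> + 1 + real N)) D"
  proof
    assume P: "lead_coeff P = 1 \<and> degree P = N \<and> D dvd gamma_poly \<beta> P"
    then obtain K where K: "gamma_poly \<beta> P = D * K" by (elim conjE dvdE)
    have top: "lead_coeff (gamma_poly \<beta> P) = Gamma (\<beta> + 1 + real N)"
    proof -
      have "degree P = N" "lead_coeff P = 1" using P by blast+
      then show ?thesis by (simp add: degree_gamma_poly[OF \<beta>] coeff_gamma_poly)
    qed
    then have "K \<noteq> 0" "D \<noteq> 0" using G lead_D K by auto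
    then have "degree K = 0"
      using P K degree_gamma_poly[OF \<beta>, of P] deg_D by (simp add: degree_mult_eq)
    then obtain d where "K = [:d:]" by (elim degree_eq_zeroE)
    with K have eq: "gamma_poly \<beta> P = smult d D" by simp
    then have "d = Gamma (\<beta> + 1 + real N)"
      using top lead_D unfolding eq lead_coeff_smult by simp
    with eq show "gamma_poly \<beta> P = smult (Gamma (\<beta> + 1 + real N)) D" by simp
  next
    assume eq: "gamma_poly \<beta> P = smult (Gamma (\<beta> + 1 + real N)) D"
    then have "degree P = N"
      using degree_gamma_poly[OF \<beta>, of P] deg_D G by simp
    moreover have "coeff P N * Gamma (\<beta> + 1 + real N) = Gamma (\<beta> + 1 + real N)"
      using arg_cong[OF eq, of "\<lambda>p. coeff p N"] lead_D deg_D by (simp add: coeff_gamma_poly)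
    ultimately show "lead_coeff P = 1 \<and> degree P = N \<and> D dvd gamma_poly \<beta> P"
      using G by (simp add: eq dvd_smult)
  qed
  finally show ?thesis .
qed

corollary multiple_laguerre2_eq_laguerre_poly:
  fixes r :: nat and n :: "nat \<Rightarrow> nat" and \<beta> :: real and b :: "nat \<Rightarrow> real"
  assumes b: "\<And>j. j \<in> {1..r} \<Longrightarrow> b j > 0" "inj_on b {1..r}" and \<beta>: "\<beta> \<ge> 0"
    and cs: "length cs = (\<Sum>i=1..r. n i)" "(\<Prod>c\<leftarrow>cs. [:- c, 1:]) = (\<Prod>j=1..r. [:- (1 / b j), 1:] ^ n j)"
  shows "multiple_laguerre2 r n \<beta> b = laguerre_poly (\<beta> + real (length cs)) cs"
proof -
  define N where "N = length cs"
  define L where "L = laguerre_poly (\<beta> + real N) cs"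
  have degL: "degree L = N"
    using degree_lead_coeff_laguerre_poly by (simp add: L_def N_def)
  have gL: "gamma_poly \<beta> L = smult (Gamma (\<beta> + 1 + real N)) (\<Prod>c\<leftarrow>cs. [:- c, 1:])"
  proof (rule poly_eqI)
    fix m
    show "coeff (gamma_poly \<beta> L) m = coeff (smult (Gamma (\<beta> + 1 + real N)) (\<Prod>c\<leftarrow>cs. [:- c, 1:])) m"
    proof (cases "m \<le> N")
      case True
      then have "falling_factorial (\<beta> + real N) (N - m) * Gamma (\<beta> + 1 + real m) = Gamma (\<beta> + 1 + real N)"
        using Gamma_falling_factorial[OF \<beta>, of m "N - m"] by simp
      then show ?thesis
        using True coeff_laguerre_poly[of m cs "\<beta> + real N"]
        by (simp add: coeff_gamma_poly L_def N_def mult.assoc)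
    next
      case False
      have "degree (\<Prod>c\<leftarrow>cs. [:- c, 1:]) = N"
        unfolding cs(2) N_def cs(1) by (subst degree_prod_sum_eq) (auto simp: degree_power_eq)
      with False degL show ?thesis by (simp add: coeff_gamma_poly coeff_eq_0)
    qed
  qed
  have inj: "P = Q" if "gamma_poly \<beta> P = gamma_poly \<beta> Q" for P Q
  proof (rule poly_eqI)
    fix m
    have "Gamma (\<beta> + 1 + real m) \<noteq> 0" using Gamma_shift_pos[OF \<beta>, of m] by simp
    then show "coeff P m = coeff Q m"
      using arg_cong[OF that, of "\<lambda>p. coeff p m"] by (simp add: coeff_gamma_poly)
  qed
  have "is_multiple_laguerre2 r n \<beta> b P \<longleftrightarrow> gamma_poly \<beta> P = gamma_poly \<beta> L" for P
    unfolding gL by (subst is_multiple_laguerre2_iff[OF b \<beta>]) (simp_all add: cs N_def)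
  then have "is_multiple_laguerre2 r n \<beta> b P \<longleftrightarrow> P = L" for P
    using inj by blast
  then show ?thesis
    unfolding multiple_laguerre2_def N_def[symmetric] L_def[symmetric]
    by (intro the_equality) auto
qed

section \<open>The S-transform of the Marchenko--Pastur distribution\<close>

text \<open>Without its factor \<open>1 / x\<close> the Marchenko--Pastur density is a semicircle density, up to a constant; so each moment of the former is
  a constant times the preceding moment of the latter.\<close>
definition semicircle_moment :: "real \<Rightarrow> real \<Rightarrow> nat \<Rightarrow> real" where
  "semicircle_moment m p k = integral {m..p} (\<lambda>x. x ^ k * sqrt ((p - x) * (x - m)))"

lemma semicircle_moment_integrable:
  "(\<lambda>x::real. x ^ k * sqrt ((p - x) * (x - m))) integrable_on {m..p}"
  by (intro integrable_continuous_interval continuous_intros)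

text \<open>Integrate the derivative of \<open>x\<^sup>k ((p - x) (x - m))\<^bsup>3/2\<^esup>\<close>, which vanishes at both ends. For
  \<open>k = 0\<close> the moment of index \<open>k - 1 = 0\<close> enters with the factor \<open>0\<close>.\<close>
lemma semicircle_moment_recurrence:
  assumes "m \<le> p"
  shows "(real k + 3) * semicircle_moment m p (Suc k)
    = (real k + 3 / 2) * (p + m) * semicircle_moment m p k - real k * (p * m) * semicircle_moment m p (k - 1)"
proof -
  define D where "D x = (p - x) * (x - m)" for x
  define I where "I = semicircle_moment m p"
  define f' where "f' x = ((real k + 3 / 2) * (p + m)) * (x ^ k * sqrt (D x))
      - (real k * (p * m)) * (x ^ (k - 1) * sqrt (D x)) - (real k + 3) * (x ^ Suc k * sqrt (D x))" for x
  have I: "((\<lambda>x. x ^ k * sqrt (D x)) has_integral I k) {m..p}" for k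
    unfolding I_def semicircle_moment_def D_def
    by (rule integrable_integral[OF semicircle_moment_integrable])
  have by_linearity: "(f' has_integral ((real k + 3 / 2) * (p + m)) * I k - (real k * (p * m)) * I (k - 1)
      - (real k + 3) * I (Suc k)) {m..p}"
    unfolding f'_def by (intro has_integral_diff has_integral_mult_right I)
  have by_calculus: "(f' has_integral p ^ k * (D p * sqrt (D p)) - m ^ k * (D m * sqrt (D m))) {m..p}"
  proof (rule fundamental_theorem_of_calculus_interior[OF assms])
    show "continuous_on {m..p} (\<lambda>x. x ^ k * (D x * sqrt (D x)))"
      unfolding D_def by (intro continuous_intros)
    fix x assume x: "x \<in> {m<..<p}"
    then have D: "D x > 0" by (simp add: D_def)
    have dD: "(D has_real_derivative (p + m - 2 * x)) (at x)"
      unfolding D_def by (auto intro!: derivative_eq_intros)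
    have xk: "real k * x ^ (k - 1) * x = real k * x ^ k"
      by (cases k) simp_all
    have xk2: "real k * x ^ (k - 1) * (x * x) = real k * (x * x ^ k)"
      by (cases k) simp_all
    have "((\<lambda>x. x ^ k * (D x * sqrt (D x))) has_real_derivative
        real k * x ^ (k - 1) * (D x * sqrt (D x)) + x ^ k * ((p + m - 2 * x) * sqrt (D x)
          + D x * ((p + m - 2 * x) * (inverse (sqrt (D x)) / 2)))) (at x)"
      using D by (auto intro!: derivative_eq_intros dD DERIV_real_sqrt)
    also have "D x * ((p + m - 2 * x) * (inverse (sqrt (D x)) / 2)) = (p + m - 2 * x) * sqrt (D x) / 2"
    proof -
      have "D x * inverse (sqrt (D x)) = sqrt (D x)"
        using D by (simp add: field_simps)
      moreover have "D x * ((p + m - 2 * x) * (inverse (sqrt (D x)) / 2))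
          = (p + m - 2 * x) * (D x * inverse (sqrt (D x))) / 2" by simp
      ultimately show ?thesis by (simp only:)
    qed
    also have "real k * x ^ (k - 1) * (D x * sqrt (D x)) + x ^ k * ((p + m - 2 * x) * sqrt (D x)
        + (p + m - 2 * x) * sqrt (D x) / 2)
      = sqrt (D x) * ((p + m) * (real k * x ^ (k - 1) * x) - p * m * (real k * x ^ (k - 1))
          - real k * x ^ (k - 1) * (x * x) + 3 / 2 * (p + m - 2 * x) * x ^ k)"
    proof -
      have "a * (D x * s) + b * ((p + m - 2 * x) * s + (p + m - 2 * x) * s / 2)
          = s * ((p + m) * (a * x) - p * m * a - a * (x * x) + 3 / 2 * (p + m - 2 * x) * b)" for a b s
        by (simp add: D_def field_simps)
      then show ?thesis .
    qed
    also have "\<dots> = f' x"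
      unfolding xk xk2 f'_def by (simp add: algebra_simps)
    finally show "((\<lambda>x. x ^ k * (D x * sqrt (D x))) has_vector_derivative f' x) (at x)"
      by (simp add: has_real_derivative_iff_has_vector_derivative)
  qed
  have "((real k + 3 / 2) * (p + m)) * I k - (real k * (p * m)) * I (k - 1)
      - (real k + 3) * I (Suc k) = 0"
    using has_integral_unique[OF by_linearity by_calculus] by (simp add: D_def)
  then show ?thesis unfolding I_def by linarith
qed

lemma semicircle_area:
  assumes "m < p"
  shows "semicircle_moment m p 0 = pi * (p - m)\<^sup>2 / 8"
proof -
  define R c where "R = (p - m) / 2" and "c = (p + m) / 2"
  define F where "F x = ((x - c) * sqrt ((p - x) * (x - m)) + R\<^sup>2 * arcsin ((x - c) / R)) / 2" for x
  have R: "R > 0" using assms by (simp add: R_def)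
  have ratio: "-1 \<le> (x - c) / R" "(x - c) / R \<le> 1" if "x \<in> {m..p}" for x
    using that R by (simp_all add: field_simps) (simp_all add: R_def c_def field_simps)
  have ratio': "-1 < (x - c) / R" "(x - c) / R < 1" if "x \<in> {m<..<p}" for x
    using that R by (simp_all add: field_simps) (simp_all add: R_def c_def field_simps)
  have "((\<lambda>x. x ^ 0 * sqrt ((p - x) * (x - m))) has_integral F p - F m) {m..p}"
  proof (rule fundamental_theorem_of_calculus_interior)
    show "continuous_on {m..p} F"
      unfolding F_def using ratio R by (intro continuous_intros) auto
    fix x assume x: "x \<in> {m<..<p}"
    define D where "D = (p - x) * (x - m)"
    have D: "D > 0" using x by (simp add: D_def)
    have D_eq: "D = R\<^sup>2 - (x - c)\<^sup>2"
      by (simp add: D_def R_def c_def power2_eq_square field_simps)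
    have "sqrt (1 - ((x - c) / R)\<^sup>2) = sqrt D / R"
    proof -
      have "1 - ((x - c) / R)\<^sup>2 = D / R\<^sup>2"
        unfolding D_eq power_divide diff_divide_distrib[of "R\<^sup>2"] using R by simp
      then show ?thesis using R by (simp add: real_sqrt_divide)
    qed
    then have arc: "((\<lambda>x. arcsin ((x - c) / R)) has_real_derivative 1 / sqrt D) (at x)"
      using ratio'[OF x] R by (auto intro!: derivative_eq_intros simp: field_simps)
    have sq: "((\<lambda>x. sqrt ((p - x) * (x - m))) has_real_derivative (p + m - 2 * x) / (2 * sqrt D)) (at x)"
      using D unfolding D_def by (auto intro!: derivative_eq_intros simp: field_simps)
    have lin: "((\<lambda>x. x - c) has_real_derivative 1) (at x)"
      by (auto intro!: derivative_eq_intros)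
    have "(F has_real_derivative (1 * sqrt ((p - x) * (x - m)) + (p + m - 2 * x) / (2 * sqrt D) * (x - c)
        + R\<^sup>2 * (1 / sqrt D)) / 2) (at x)"
      unfolding F_def by (intro DERIV_cdivide DERIV_add DERIV_mult DERIV_cmult lin arc sq)
    also have "1 * sqrt ((p - x) * (x - m)) + (p + m - 2 * x) / (2 * sqrt D) * (x - c) + R\<^sup>2 * (1 / sqrt D)
        = sqrt D + (x - c) * ((p + m - 2 * x) / (2 * sqrt D)) + R\<^sup>2 * (1 / sqrt D)"
      by (simp add: D_def)
    also have "(sqrt D + (x - c) * ((p + m - 2 * x) / (2 * sqrt D)) + R\<^sup>2 * (1 / sqrt D)) / 2 = sqrt D"
    proof -
      have "(x - c) * (p + m - 2 * x) = - 2 * (x - c)\<^sup>2"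
        by (simp add: c_def power2_eq_square field_simps)
      moreover have "(x - c) * ((p + m - 2 * x) / (2 * sqrt D)) + R\<^sup>2 * (1 / sqrt D)
          = ((x - c) * (p + m - 2 * x) / 2 + R\<^sup>2) / sqrt D"
        by (simp add: add_divide_distrib)
      ultimately have "(x - c) * ((p + m - 2 * x) / (2 * sqrt D)) + R\<^sup>2 * (1 / sqrt D) = D / sqrt D"
        by (simp only: D_eq) simp
      then show ?thesis using D by (simp add: real_div_sqrt)
    qed
    finally show "(F has_vector_derivative x ^ 0 * sqrt ((p - x) * (x - m))) (at x)"
      by (simp add: has_real_derivative_iff_has_vector_derivative D_def)
  qed (use assms in simp)
  moreover have "F p - F m = pi * (p - m)\<^sup>2 / 8"
  proof -
    have ratios: "(p - c) / R = 1" "(m - c) / R = -1"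
      using R by (simp_all add: R_def c_def field_simps)
    have "F p - F m = R\<^sup>2 * pi / 2" by (simp only: F_def ratios) simp
    then show ?thesis by (simp add: R_def power_divide)
  qed
  ultimately show ?thesis
    unfolding semicircle_moment_def by (simp add: integral_unique)
qed

lemma marchenko_pastur_moment:
  assumes "l \<ge> 1"
  defines "m \<equiv> (sqrt l - 1)\<^sup>2" and "p \<equiv> (sqrt l + 1)\<^sup>2"
  shows "(\<integral>x. x ^ Suc k \<partial>marchenko_pastur (1 / l)) = semicircle_moment m p k / (2 * pi)"
proof -
  define f where "f = mp_density (1 / l)"
  have l: "l > 0" "sqrt l > 0" using assms by auto
  have edges: "(1 + sqrt (1 / l))\<^sup>2 / (1 / l) = p" "(1 - sqrt (1 / l))\<^sup>2 / (1 / l) = m"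
  proof -
    have "(1 + sqrt (1 / l)) * sqrt l = sqrt l + 1" "(1 - sqrt (1 / l)) * sqrt l = sqrt l - 1"
      using l by (simp_all add: real_sqrt_divide field_simps)
    moreover have "(y\<^sup>2 / (1 / l)) = (y * sqrt l)\<^sup>2" for y
      using l by (simp add: power_mult_distrib)
    ultimately show "(1 + sqrt (1 / l))\<^sup>2 / (1 / l) = p" "(1 - sqrt (1 / l))\<^sup>2 / (1 / l) = m"
      by (simp_all add: p_def m_def)
  qed
  have f: "f x = 1 / (2 * pi * x) * sqrt ((p - x) * (x - m)) * indicator {m..p} x" for x
    unfolding f_def mp_density_def Let_def edges ..
  have m0: "m \<ge> 0" by (simp add: m_def)
  have f_nonneg: "f x \<ge> 0" for x
    using m0 by (auto simp: f indicator_def intro!: mult_nonneg_nonneg)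
  have f_meas: "f \<in> borel_measurable borel"
    unfolding f[abs_def] by measurable
  have "marchenko_pastur (1 / l) = density lborel (\<lambda>x. ennreal (f x))"
  proof (rule measure_eqI)
    fix A assume "A \<in> sets (marchenko_pastur (1 / l))"
    then have A: "A \<in> sets borel" by simp
    have "max (1 - 1 / (1 / l)) 0 = 0" using assms by simp
    then show "emeasure (marchenko_pastur (1 / l)) A = emeasure (density lborel (\<lambda>x. ennreal (f x))) A"
      using A f_meas by (simp add: emeasure_marchenko_pastur emeasure_density f_def)
  qed simp
  then have "(\<integral>x. x ^ Suc k \<partial>marchenko_pastur (1 / l)) = (\<integral>x. f x * x ^ Suc k \<partial>lborel)"
    using f_meas f_nonneg by (simp add: integral_density)
  also have "\<dots> = (\<integral>x. indicator {m..p} x *\<^sub>R (x ^ k * sqrt ((p - x) * (x - m)) / (2 * pi)) \<partial>lborel)"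
  proof (rule integral_cong_AE)
    have "AE x in lborel. x \<noteq> (0::real)"
      by (rule AE_lborel_singleton)
    then show "AE x in lborel. f x * x ^ Suc k = indicator {m..p} x *\<^sub>R (x ^ k * sqrt ((p - x) * (x - m)) / (2 * pi))"
      by eventually_elim (simp add: f indicator_def)
  qed (use f_meas in measurable)
  also have "\<dots> = integral {m..p} (\<lambda>x. x ^ k * sqrt ((p - x) * (x - m)) / (2 * pi))"
  proof -
    have "continuous_on {m..p} (\<lambda>x. x ^ k * sqrt ((p - x) * (x - m)) / (2 * pi))"
      by (intro continuous_intros) auto
    then have "set_integrable lborel {m..p} (\<lambda>x. x ^ k * sqrt ((p - x) * (x - m)) / (2 * pi))"
      by (rule borel_integrable_atLeastAtMost')
    from set_borel_integral_eq_integral(2)[OF this] show ?thesis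
      by (simp add: set_lebesgue_integral_def)
  qed
  finally show ?thesis by (simp add: semicircle_moment_def)
qed

text \<open>\<open>S / D\<close> has derivative zero.\<close>
lemma fps_eq_of_logarithmic_derivative:
  fixes D S :: "real fps"
  assumes "D * fps_deriv S = fps_deriv D * S" "D $ 0 \<noteq> 0" "S $ 0 = D $ 0"
  shows "S = D"
proof -
  define Y where "Y = S * inverse D"
  have S: "S = Y * D"
    using assms(2) by (simp add: Y_def mult.assoc inverse_mult_eq_1)
  have "D * D * fps_deriv Y = 0"
    using assms(1) by (simp add: S algebra_simps)
  moreover have "D \<noteq> 0" using assms(2) by auto
  ultimately have "fps_deriv Y = 0" by simp
  then obtain y where y: "Y = fps_const y" by (auto simp: fps_deriv_eq_0_iff)
  with S assms have "y = 1" by simp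
  with y S show ?thesis by simp
qed

text \<open>The three-term recurrence of the moments says that
  \<open>T = 1 - (l + 1) X - 2 X \<psi>\<close> has the same logarithmic derivative as the square root of
  \<open>D = (1 - (l + 1) X)\<^sup>2 - 4 l X\<^sup>2\<close>. Hence \<open>T\<^sup>2 = D\<close>, which is the quadratic equation for \<open>\<psi>\<close>.\<close>
lemma marchenko_pastur_moment_series:
  assumes "l \<ge> 1"
  defines "\<psi> \<equiv> moment_series (marchenko_pastur (1 / l))"
  shows "fps_X * ((1 + \<psi>) * (fps_const l + \<psi>)) = \<psi>" "fps_nth \<psi> 1 = l"
proof -
  define m p where "m = (sqrt l - 1)\<^sup>2" and "p = (sqrt l + 1)\<^sup>2"
  define M where "M = semicircle_moment m p"
  have l: "l > 0" "sqrt l > 0" using assms by auto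
  have diff: "p - m = 4 * sqrt l" and sum: "p + m = 2 * (l + 1)" and prod: "p * m = (l - 1)\<^sup>2"
  proof -
    show "p - m = 4 * sqrt l" "p + m = 2 * (l + 1)"
      using l by (simp_all add: p_def m_def power2_eq_square algebra_simps)
    have "(sqrt l + 1) * (sqrt l - 1) = l - 1" using l by (simp add: algebra_simps)
    then show "p * m = (l - 1)\<^sup>2"
      by (simp add: p_def m_def flip: power_mult_distrib)
  qed
  have "m < p" using diff l(2) by linarith
  then have M0: "M 0 = 2 * pi * l"
    using l by (simp add: M_def semicircle_area diff power_mult_distrib)
  have Mrec: "(real k + 3) * M (Suc k)
      = (2 * real k + 3) * (l + 1) * M k - real k * (l - 1)\<^sup>2 * M (k - 1)" for k
    using semicircle_moment_recurrence[of m p k] \<open>m < p\<close>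
    unfolding M_def sum prod by (simp add: algebra_simps)
  have \<psi>: "\<psi> $ 0 = 0" "\<psi> $ Suc k = M k / (2 * pi)" for k
    using marchenko_pastur_moment[OF assms(1), of k]
    by (simp_all add: \<psi>_def moment_series_def M_def m_def p_def)
  show "\<psi> $ 1 = l" using \<psi>(2)[of 0] M0 by simp
  define T where "T = 1 - fps_const (l + 1) * fps_X - 2 * (fps_X * \<psi>)"
  define D where "D = 1 - fps_const (2 * (l + 1)) * fps_X + fps_const ((l - 1)\<^sup>2) * (fps_X * fps_X)"
  have T0: "T $ 0 = 1" and T1: "T $ Suc 0 = - (l + 1)" and T2: "T $ Suc (Suc k) = - M k / pi" for k
    by (simp_all add: T_def \<psi> fps_numeral_nth mult.assoc numeral_fps_const)
  have TD: "D * fps_deriv T = (fps_const ((l - 1)\<^sup>2) * fps_X - fps_const (l + 1)) * T"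
  proof (rule fps_ext)
    fix n
    consider "n = 0" | "n = 1" | "n = 2" | j where "n = Suc (Suc (Suc j))"
      by (metis One_nat_def Suc_1 not0_implies_Suc)
    then show "(D * fps_deriv T) $ n = ((fps_const ((l - 1)\<^sup>2) * fps_X - fps_const (l + 1)) * T) $ n"
    proof cases
      case 1
      then show ?thesis by (simp add: D_def T0 T1 algebra_simps)
    next
      case 2
      then show ?thesis
        by (simp add: D_def T0 T1 T2 M0 algebra_simps power2_eq_square)
    next
      case 3
      have "M (Suc 0) = (l + 1) * M 0" proof -
        have "3 * M (Suc 0) = 3 * ((l + 1) * M 0)" using Mrec[of 0] by (simp add: algebra_simps)
        then show ?thesis by (simp only: mult_cancel_left) simp
      qed
      with 3 show ?thesis
        by (simp add: numeral_2_eq_2 D_def T0 T1 T2 M0 algebra_simps power2_eq_square)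
           (simp add: field_simps)
    next
      case (4 j)
      have "(real j + 4) * M (Suc (Suc j)) = (2 * real j + 5) * (l + 1) * M (Suc j) - (real j + 1) * (l - 1)\<^sup>2 * M j"
        using Mrec[of "Suc j"] by (simp add: algebra_simps)
      then have "(real j + 4) * (- M (Suc (Suc j)) / pi)
          = (2 * real j + 5) * (l + 1) * (- M (Suc j) / pi) - (real j + 1) * (l - 1)\<^sup>2 * (- M j / pi)"
        unfolding times_divide_eq_right mult_minus_right by (simp add: diff_divide_distrib)
      then have "(real j + 4) * T $ (j + 4) = (2 * real j + 5) * (l + 1) * T $ (j + 3)
          - (real j + 1) * (l - 1)\<^sup>2 * T $ (j + 2)"
        by (simp add: T2 eval_nat_numeral)
      then show ?thesis
        by (simp add: 4 D_def eval_nat_numeral algebra_simps)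
    qed
  qed
  have "T * T = D"
  proof (rule fps_eq_of_logarithmic_derivative)
    have "fps_deriv D = 2 * (fps_const ((l - 1)\<^sup>2) * fps_X - fps_const (l + 1))"
      by (simp add: D_def numeral_fps_const algebra_simps)
    moreover have "D * fps_deriv (T * T) = 2 * T * (D * fps_deriv T)"
      by (simp add: algebra_simps)
    ultimately show "D * fps_deriv (T * T) = fps_deriv D * (T * T)"
      unfolding TD by (simp only: mult_ac)
  qed (simp_all add: D_def T0)
  moreover have "T * T - D = 4 * fps_X * (fps_X * ((1 + \<psi>) * (fps_const l + \<psi>)) - \<psi>)"
  proof -
    define L where "L = fps_const l"
    have const_eqs: "fps_const (l + 1) = L + 1" "fps_const (2 * (l + 1)) = 2 * (L + 1)"
      "fps_const ((l - 1)\<^sup>2) = (L - 1) * (L - 1)"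
      by (simp_all add: L_def power2_eq_square numeral_fps_const flip: fps_const_add fps_const_mult fps_const_sub)
    show ?thesis
      unfolding T_def D_def const_eqs L_def[symmetric] by (simp add: algebra_simps)
  qed
  ultimately show "fps_X * ((1 + \<psi>) * (fps_const l + \<psi>)) = \<psi>" by simp
qed

theorem S_transform_marchenko_pastur:
  assumes "l \<ge> 1"
  shows "S_transform (marchenko_pastur (1 / l)) = inverse (fps_const l + fps_X)"
proof -
  define \<psi> where "\<psi> = moment_series (marchenko_pastur (1 / l))"
  define g where "g = fps_inv \<psi>"
  have \<psi>0: "\<psi> $ 0 = 0" by (simp add: \<psi>_def moment_series_def)
  have \<psi>1: "\<psi> $ 1 \<noteq> 0"
    using marchenko_pastur_moment_series(2)[OF assms] assms by (simp add: \<psi>_def)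
  have g0: "g $ 0 = 0" by (simp add: g_def fps_inv_def)
  have inv: "fps_compose \<psi> g = fps_X"
    unfolding g_def using \<psi>0 \<psi>1 by (rule fps_inv_right)
  have "fps_compose (fps_X * ((1 + \<psi>) * (fps_const l + \<psi>))) g = fps_compose \<psi> g"
    using marchenko_pastur_moment_series(1)[OF assms] by (simp add: \<psi>_def)
  then have g: "(1 + fps_X) * g * (fps_const l + fps_X) = fps_X"
    by (simp add: fps_compose_mult_distrib[OF g0] fps_compose_add_distrib inv g0 mult_ac)
  have l: "(fps_const l + fps_X) $ 0 \<noteq> (0::real)" using assms by simp
  have "(1 + fps_X) * g = (1 + fps_X) * g * (fps_const l + fps_X) * inverse (fps_const l + fps_X)"
    using l by (simp add: mult.assoc inverse_mult_eq_1')
  then have "(1 + fps_X) * g = inverse (fps_const l + fps_X) * fps_X"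
    unfolding g by (simp add: mult.commute)
  then show ?thesis
    unfolding S_transform_def g_def \<psi>_def
    by (simp only: nonzero_mult_div_cancel_right[OF fps_X_neq_zero])
qed

section \<open>Empirical measures, moments and the S-transform\<close>

lemma integral_atomic_measure:
  fixes f :: "'a::topological_space \<Rightarrow> real"
  assumes "finite I" "\<And>i. i \<in> I \<Longrightarrow> w i \<ge> 0" "f \<in> borel_measurable borel"
  shows "(\<integral>x. f x \<partial>atomic_measure I w y) = (\<Sum>i\<in>I. w i * f (y i))"
proof -
  have "y \<in> measurable (point_measure I (\<lambda>i. ennreal (w i))) borel" by simp
  then have "(\<integral>x. f x \<partial>atomic_measure I w y) = (\<integral>i. f (y i) \<partial>point_measure I (\<lambda>i. ennreal (w i)))"
    unfolding atomic_measure_def using assms(3) by (rule integral_distr)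
  also have "\<dots> = (\<Sum>i\<in>I. w i * f (y i))"
    using assms(1,2) by (simp add: lebesgue_integral_point_measure_finite)
  finally show ?thesis .
qed

lemma sum_count_mult_eq_sum_mset:
  fixes f :: "'a \<Rightarrow> real"
  assumes "finite S" "set_mset B \<subseteq> S"
  shows "(\<Sum>z\<in>S. real (count B z) * f z) = (\<Sum>z\<in>#B. f z)"
  using assms(2)
proof (induction B)
  case (add x B)
  have "real (count (add_mset x B) z) * f z = real (count B z) * f z + (if z = x then f x else 0)" for z
    by (simp add: algebra_simps)
  then show ?case
    using add assms(1) by (simp add: sum.distrib sum.delta)
qed simp

lemma sets_zero_distribution [simp]: "sets (zero_distribution p) = sets borel"
  by (simp add: zero_distribution_def atomic_measure_def)

lemma integral_zero_distribution:
  fixes f :: "complex \<Rightarrow> real"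
  assumes "f \<in> borel_measurable borel"
  shows "(\<integral>z. f z \<partial>zero_distribution (map_poly complex_of_real (poly_of_roots A)))
    = (\<Sum>x\<in>#A. f (complex_of_real x)) / real (size A)"
proof -
  define B where "B = image_mset complex_of_real A"
  define p where "p = poly_of_roots B"
  have p: "map_poly complex_of_real (poly_of_roots A) = p"
    by (simp add: p_def B_def map_poly_of_real_poly_of_roots)
  have roots: "{z. poly p z = 0} = set_mset B"
    by (auto simp: p_def poly_of_roots_root_iff)
  have ord: "order z p = count B z" for z
    using count_proots[of p z] by (simp add: p_def proots_poly_of_roots)
  have "(\<integral>z. f z \<partial>zero_distribution p) = (\<Sum>z\<in>set_mset B. real (count B z) / real (degree p) * f z)"
    unfolding zero_distribution_def roots by (subst integral_atomic_measure) (use assms in \<open>simp_all add: ord\<close>)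
  also have "\<dots> = (\<Sum>z\<in>set_mset B. real (count B z) * f z) / real (size A)"
    by (simp add: p_def B_def sum_divide_distrib)
  also have "(\<Sum>z\<in>set_mset B. real (count B z) * f z) = (\<Sum>z\<in>#B. f z)"
    by (rule sum_count_mult_eq_sum_mset) simp_all
  finally show ?thesis unfolding p by (simp add: B_def multiset.map_comp comp_def)
qed

text \<open>Helly's selection theorem and the continuity results for weak convergence concern measures on the
  real line, so the zero distribution, which lives on \<open>\<complex>\<close>, is projected there. Nothing is lost as all zeros are real.\<close>
definition root_measure :: "real multiset \<Rightarrow> real measure" where
  "root_measure A = distr (zero_distribution (map_poly complex_of_real (poly_of_roots A))) borel Re"

lemma integral_root_measure:
  fixes f :: "real \<Rightarrow> real"
  assumes "f \<in> borel_measurable borel"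
  shows "(\<integral>x. f x \<partial>root_measure A) = (\<Sum>x\<in>#A. f x) / real (size A)"
proof -
  have "Re \<in> borel_measurable borel" by (intro borel_measurable_continuous_onI continuous_intros)
  then have fRe: "(\<lambda>z. f (Re z)) \<in> borel_measurable borel"
    using assms by (rule measurable_compose)
  have "(\<integral>x. f x \<partial>root_measure A)
      = (\<integral>z. f (Re z) \<partial>zero_distribution (map_poly complex_of_real (poly_of_roots A)))"
    unfolding root_measure_def
    using assms by (intro integral_distr) (simp_all add: measurable_cong_sets[OF sets_zero_distribution refl])
  also have "\<dots> = (\<Sum>x\<in>#A. f (Re (complex_of_real x))) / real (size A)"
    by (rule integral_zero_distribution[OF fRe])
  finally show ?thesis by simp
qed

lemma real_distribution_root_measure:
  assumes "A \<noteq> {#}"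
  shows "real_distribution (root_measure A)"
proof -
  define p where "p = poly_of_roots (image_mset complex_of_real A)"
  have Re: "Re \<in> measurable (zero_distribution q) borel" for q
    by (simp add: measurable_cong_sets[OF sets_zero_distribution refl])
  have roots: "{z. poly p z = 0} = set_mset (image_mset complex_of_real A)"
    by (auto simp: p_def poly_of_roots_root_iff)
  have ord: "order z p = count (image_mset complex_of_real A) z" for z
    using count_proots[of p z] by (simp add: p_def proots_poly_of_roots)
  have "emeasure (zero_distribution p) UNIV
      = (\<Sum>z\<in>{z. poly p z = 0}. ennreal (real (order z p) / real (degree p)))"
    unfolding zero_distribution_def by (subst emeasure_atomic_measure) (simp_all add: roots)
  also have "\<dots> = ennreal (\<Sum>z\<in>{z. poly p z = 0}. real (order z p) / real (degree p))"
    by (rule sum_ennreal) simp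
  also have "(\<Sum>z\<in>{z. poly p z = 0}. real (order z p) / real (degree p)) = 1"
  proof -
    have "(\<Sum>z\<in>{z. poly p z = 0}. real (order z p))
        = real (size (image_mset complex_of_real A))"
      unfolding roots ord size_multiset_overloaded_eq by simp
    then show ?thesis
      using assms by (simp add: p_def flip: sum_divide_distrib)
  qed
  finally have "prob_space (zero_distribution p)"
    by (intro prob_spaceI) (simp add: zero_distribution_def atomic_measure_def)
  then have "prob_space (root_measure A)"
    unfolding root_measure_def map_poly_of_real_poly_of_roots p_def[symmetric]
    by (rule prob_space.prob_space_distr[OF _ Re])
  then show ?thesis
    by (simp add: real_distribution_def real_distribution_axioms_def root_measure_def)
qed

text \<open>The Taylor expansion of the characteristic function has the moments as coefficients, and for a
  bounded distribution its remainder tends to zero.\<close>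
lemma moments_determine_distribution:
  assumes "real_distribution M1" "real_distribution M2"
    and "AE x in M1. \<bar>x\<bar> \<le> B" "AE x in M2. \<bar>x\<bar> \<le> B"
    and "\<And>k. (\<integral>x. x ^ k \<partial>M1) = (\<integral>x. x ^ k \<partial>M2)"
  shows "M1 = M2"
proof (rule Levy_uniqueness[OF assms(1,2)], rule ext)
  fix t
  have bound: "cmod (char M t - (\<Sum>k\<le>n. ((\<i> * t) ^ k / fact k) * (\<integral>x. x ^ k \<partial>M)))
      \<le> 2 * (inverse (fact n) * (\<bar>t\<bar> * B) ^ n)"
    if M: "real_distribution M" "AE x in M. \<bar>x\<bar> \<le> B" for M n
  proof -
    interpret real_distribution M by (rule M(1))
    have pow: "AE x in M. norm (x ^ k) \<le> B ^ k" for k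
      using M(2) by eventually_elim (simp add: power_abs power_mono)
    have int: "integrable M (\<lambda>x. x ^ k)" for k
      using pow by (rule integrable_const_bound) simp
    have "cmod (char M t - (\<Sum>k\<le>n. ((\<i> * t) ^ k / fact k) * (\<integral>x. x ^ k \<partial>M)))
        \<le> (2 * \<bar>t\<bar> ^ n / fact n) * (\<integral>x. \<bar>x\<bar> ^ n \<partial>M)"
      by (rule char_approx1) (rule int)
    also have "\<dots> \<le> (2 * \<bar>t\<bar> ^ n / fact n) * B ^ n"
    proof (rule mult_left_mono)
      have "(\<integral>x. \<bar>x\<bar> ^ n \<partial>M) \<le> (\<integral>x. B ^ n \<partial>M)"
        using pow[of n] integrable_norm[OF int[of n]]
        by (intro integral_mono_AE) (simp_all add: power_abs)
      also have "\<dots> = B ^ n" using prob_space by simp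
      finally show "(\<integral>x. \<bar>x\<bar> ^ n \<partial>M) \<le> B ^ n" .
    qed simp
    finally show ?thesis by (simp add: power_mult_distrib field_simps)
  qed
  have diff: "cmod (char M1 t - char M2 t) \<le> 4 * (inverse (fact n) * (\<bar>t\<bar> * B) ^ n)" for n
  proof -
    define s where "s = (\<Sum>k\<le>n. ((\<i> * t) ^ k / fact k) * (\<integral>x. x ^ k \<partial>M1))"
    have "cmod (char M1 t - s) \<le> 2 * (inverse (fact n) * (\<bar>t\<bar> * B) ^ n)"
      unfolding s_def by (rule bound) (fact assms)+
    moreover have "cmod (char M2 t - s) \<le> 2 * (inverse (fact n) * (\<bar>t\<bar> * B) ^ n)"
      unfolding s_def assms(5) by (rule bound) (fact assms)+
    moreover have "cmod (char M1 t - char M2 t) \<le> cmod (char M1 t - s) + cmod (char M2 t - s)"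
      using norm_triangle_ineq4[of "char M1 t - s" "char M2 t - s"] by simp
    ultimately show ?thesis by linarith
  qed
  have "(\<lambda>n. 4 * (inverse (fact n) * (\<bar>t\<bar> * B) ^ n)) \<longlonglongrightarrow> 4 * 0"
    by (intro tendsto_mult_left summable_LIMSEQ_zero summable_exp)
  then have "cmod (char M1 t - char M2 t) \<le> 4 * 0"
    by (rule LIMSEQ_le_const) (use diff in blast)
  then show "char M1 t = char M2 t" by simp
qed

lemma admissibleD:
  assumes "admissible \<mu>"
  shows "real_distribution \<mu>" "\<exists>B. AE x in \<mu>. 0 \<le> x \<and> x \<le> B" "fps_nth (moment_series \<mu>) 1 \<noteq> 0"
proof -
  have prob: "prob_space \<mu>" and sets: "sets \<mu> = sets borel"
    using assms by (auto simp: admissible_def)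
  show rd: "real_distribution \<mu>"
    using prob sets by (simp add: real_distribution_def real_distribution_axioms_def)
  obtain K where K: "compact K" "K \<subseteq> {0..}" "AE x in \<mu>. x \<in> K"
    using assms by (auto simp: admissible_def)
  obtain B where B: "\<And>x. x \<in> K \<Longrightarrow> norm x \<le> B"
    using compact_imp_bounded[OF K(1)] by (auto simp: bounded_iff)
  have AE: "AE x in \<mu>. 0 \<le> x \<and> x \<le> B"
    using K(3) by eventually_elim (use K(2) B in force)
  then show "\<exists>B. AE x in \<mu>. 0 \<le> x \<and> x \<le> B" ..
  interpret real_distribution \<mu> by (rule rd)
  have int: "integrable \<mu> (\<lambda>x. x)"
  proof (rule integrable_const_bound[where B = B])
    show "AE x in \<mu>. norm x \<le> B" using AE by eventually_elim simp
  qed simp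
  show "fps_nth (moment_series \<mu>) 1 \<noteq> 0"
  proof
    assume "fps_nth (moment_series \<mu>) 1 = 0"
    then have "(\<integral>x. x \<partial>\<mu>) = 0" by (simp add: moment_series_def)
    moreover have "AE x in \<mu>. 0 \<le> x" using AE by eventually_elim simp
    ultimately have zero: "AE x in \<mu>. x = 0"
      using integral_nonneg_eq_0_iff_AE[OF int] by simp
    have "\<mu> = return borel 0"
    proof (rule measure_eqI)
      fix A assume A: "A \<in> sets \<mu>"
      show "emeasure \<mu> A = emeasure (return borel 0) A"
      proof (cases "0 \<in> A")
        case True
        then have "emeasure \<mu> A = 1"
          using zero A by (intro emeasure_eq_1_AE) (auto elim!: eventually_mono)
        then show ?thesis using True A sets by simp
      next
        case False
        then have "AE x in \<mu>. x \<notin> A" using zero by (auto elim!: eventually_mono)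
        then have "emeasure \<mu> A = 0" using A by (simp add: AE_iff_measurable[OF A] space_eq_univ)
        then show ?thesis using False A sets by simp
      qed
    qed (simp add: sets)
    then show False using assms by (simp add: admissible_def)
  qed
qed

lemma S_transform_mult_X:
  "S_transform \<mu> * fps_X = (1 + fps_X) * fps_inv (moment_series \<mu>)"
proof -
  define f where "f = (1 + fps_X) * fps_inv (moment_series \<mu>)"
  have "f = fps_shift 1 f * fps_X"
  proof (rule fps_ext)
    fix k show "fps_nth f k = fps_nth (fps_shift 1 f * fps_X) k"
      by (cases k) (simp_all add: f_def fps_inv_def)
  qed
  then have "fps_X dvd f" by (metis dvd_triv_right)
  then show ?thesis
    unfolding S_transform_def f_def[symmetric] by (rule dvd_div_mult_self)
qed

lemma S_transform_eq_imp_moment_series_eq: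
  assumes "S_transform \<mu> = S_transform \<eta>"
    and "fps_nth (moment_series \<mu>) 1 \<noteq> 0" "fps_nth (moment_series \<eta>) 1 \<noteq> 0"
  shows "moment_series \<mu> = moment_series \<eta>"
proof -
  have "(1 + fps_X) * fps_inv (moment_series \<mu>) = (1 + fps_X) * fps_inv (moment_series \<eta>)"
    using assms(1) by (simp flip: S_transform_mult_X)
  moreover have "(1 + fps_X :: real fps) \<noteq> 0"
    by (metis fps_X_nth fps_add_nth fps_one_nth fps_zero_nth add_0_right zero_neq_one)
  ultimately have "fps_inv (moment_series \<mu>) = fps_inv (moment_series \<eta>)" by simp
  moreover have "fps_inv (fps_inv (moment_series \<nu>)) = moment_series \<nu>"
    if "fps_nth (moment_series \<nu>) 1 \<noteq> 0" for \<nu>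
    using that by (intro fps_inv_idempotent) (simp_all add: moment_series_def)
  ultimately show ?thesis using assms by metis
qed

lemma admissible_eq_of_S_transform_eq:
  assumes "admissible \<mu>" "admissible \<eta>" "S_transform \<mu> = S_transform \<eta>"
  shows "\<mu> = \<eta>"
proof -
  have eq: "moment_series \<mu> = moment_series \<eta>"
    using assms admissibleD(3) by (intro S_transform_eq_imp_moment_series_eq) auto
  obtain B1 where B1: "AE x in \<mu>. 0 \<le> x \<and> x \<le> B1" using admissibleD(2)[OF assms(1)] by blast
  obtain B2 where B2: "AE x in \<eta>. 0 \<le> x \<and> x \<le> B2" using admissibleD(2)[OF assms(2)] by blast
  show ?thesis
  proof (rule moments_determine_distribution)
    show "AE x in \<mu>. \<bar>x\<bar> \<le> max B1 B2" using B1 by eventually_elim auto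
    show "AE x in \<eta>. \<bar>x\<bar> \<le> max B1 B2" using B2 by eventually_elim auto
    show "(\<integral>x. x ^ k \<partial>\<mu>) = (\<integral>x. x ^ k \<partial>\<eta>)" for k
    proof (cases "k = 0")
      case True
      interpret M: real_distribution \<mu> by (rule admissibleD(1)[OF assms(1)])
      interpret E: real_distribution \<eta> by (rule admissibleD(1)[OF assms(2)])
      show ?thesis using True M.prob_space E.prob_space by simp
    next
      case False
      then show ?thesis
        using arg_cong[OF eq, of "\<lambda>f. fps_nth f k"] by (simp add: moment_series_def)
    qed
  qed (use assms admissibleD(1) in auto)
qed

corollary free_mult_conv_eqI:
  assumes "admissible \<tau>" "S_transform \<tau> = S_transform \<mu> * S_transform \<eta>"
  shows "free_mult_conv \<mu> \<eta> = \<tau>"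
  unfolding free_mult_conv_def
  using assms by (intro the_equality) (auto intro: admissible_eq_of_S_transform_eq)

text \<open>Write \<open>\<chi>\<close> for compositional inverses. Applying \<open>\<chi>\<^sub>\<eta>\<close> to the equation gives
  \<open>\<chi>\<^sub>\<eta> \<circ> \<psi>\<^sub>\<tau> = X (l + \<psi>\<^sub>\<tau>)\<close>; composing with \<open>\<chi>\<^sub>\<tau>\<close> on the right yields
  \<open>\<chi>\<^sub>\<eta> = \<chi>\<^sub>\<tau> (l + X)\<close>.\<close>
lemma S_transform_product:
  assumes eq: "moment_series \<tau> = fps_compose (moment_series \<eta>) (fps_X * (fps_const l + moment_series \<tau>))"
    and nz: "fps_nth (moment_series \<tau>) 1 \<noteq> 0" "fps_nth (moment_series \<eta>) 1 \<noteq> 0" "l \<noteq> 0"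
  shows "S_transform \<tau> = inverse (fps_const l + fps_X) * S_transform \<eta>"
proof -
  define \<psi> g h where "\<psi> = moment_series \<tau>" and "g = fps_inv \<psi>" and "h = fps_inv (moment_series \<eta>)"
  define W where "W = fps_X * (fps_const l + \<psi>)"
  have W0: "fps_nth W 0 = 0" by (simp add: W_def)
  have \<psi>0: "fps_nth \<psi> 0 = 0" and \<eta>0: "fps_nth (moment_series \<eta>) 0 = 0"
    by (simp_all add: \<psi>_def moment_series_def)
  have g0: "fps_nth g 0 = 0" by (simp add: g_def fps_inv_def)
  have \<psi>g: "fps_compose \<psi> g = fps_X"
    unfolding g_def using \<psi>0 nz(1) by (intro fps_inv_right) (simp_all add: \<psi>_def)
  have "fps_compose h \<psi> = fps_compose h (fps_compose (moment_series \<eta>) W)"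
    using eq by (simp add: \<psi>_def W_def)
  also have "\<dots> = fps_compose (fps_compose h (moment_series \<eta>)) W"
    by (rule fps_compose_assoc[OF W0 \<eta>0])
  also have "fps_compose h (moment_series \<eta>) = fps_X"
    unfolding h_def using \<eta>0 nz(2) by (rule fps_inv)
  finally have "fps_compose h \<psi> = W" using W0 by simp
  then have "fps_compose (fps_compose h \<psi>) g = fps_compose W g" by simp
  then have "h = g * (fps_const l + fps_X)"
    by (simp add: fps_compose_assoc[OF g0 \<psi>0, symmetric] \<psi>g W_def
        fps_compose_mult_distrib[OF g0] fps_compose_add_distrib g0)
  then have "inverse (fps_const l + fps_X) * h = g"
    using nz(3) by (simp add: mult.left_commute inverse_mult_eq_1)
  then have "inverse (fps_const l + fps_X) * S_transform \<eta> * fps_X = S_transform \<tau> * fps_X"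
    by (simp add: mult.assoc S_transform_mult_X mult.left_commute flip: h_def g_def \<psi>_def)
  then show ?thesis by simp
qed

text \<open>Powers are unbounded, so weak convergence is applied to powers of the truncation of \<open>x\<close> to
  \<open>[0, C]\<close>. This changes no integral once the limit is known to live on \<open>[0, C]\<close>, and that follows by
  integrating the distance to the interval, capped at \<open>1\<close>.\<close>
lemma weak_limit_support_and_moments:
  fixes \<nu> :: "nat \<Rightarrow> real measure"
  assumes rd: "\<And>k. real_distribution (\<nu> k)" "real_distribution \<tau>"
    and conv: "weak_conv_m \<nu> \<tau>"
    and supp: "\<And>k. AE x in \<nu> k. 0 \<le> x \<and> x \<le> C" and "C \<ge> 0"
  shows "AE x in \<tau>. 0 \<le> x \<and> x \<le> C" "(\<lambda>k. \<integral>x. x ^ j \<partial>\<nu> k) \<longlonglongrightarrow> (\<integral>x. x ^ j \<partial>\<tau>)"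
proof -
  define clamp where "clamp x = max 0 (min C x)" for x
  have clamp: "clamp x = x" if "0 \<le> x \<and> x \<le> C" for x
    using that by (simp add: clamp_def)
  have cont: "isCont clamp x" for x
    unfolding clamp_def by (intro continuous_intros)
  have clamp_bd: "\<bar>clamp x\<bar> \<le> C" for x using \<open>C \<ge> 0\<close> by (simp add: clamp_def)
  have lim: "(\<lambda>k. \<integral>x. f x \<partial>\<nu> k) \<longlonglongrightarrow> (\<integral>x. f x \<partial>\<tau>)" if "\<And>x. isCont f x" "\<And>x. norm (f x) \<le> B" for f :: "real \<Rightarrow> real" and B
    using weak_conv_imp_integral_bdd_continuous_conv[OF rd conv that] .
  have meas: "f \<in> borel_measurable M" if "\<And>x. isCont f x" "sets M = sets borel" for f :: "real \<Rightarrow> real" and M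
    using that by (simp add: measurable_cong_sets[OF that(2) refl] borel_measurable_continuous_onI continuous_at_imp_continuous_on)
  interpret T: real_distribution \<tau> by (rule rd)
  define d where "d x = min 1 \<bar>x - clamp x\<bar>" for x
  have d_cont: "isCont d x" for x
    unfolding d_def by (intro continuous_intros cont)
  have d_bd: "norm (d x) \<le> 1" for x by (simp add: d_def)
  have "(\<integral>x. d x \<partial>\<nu> k) = 0" for k
  proof -
    have "AE x in \<nu> k. d x = 0" using supp[of k] by eventually_elim (simp add: d_def clamp)
    then show ?thesis by (rule integral_eq_zero_AE)
  qed
  then have "(\<integral>x. d x \<partial>\<tau>) = 0"
    using lim[of d, OF d_cont d_bd] by (simp add: LIMSEQ_const_iff)
  moreover have "integrable \<tau> d"
    by (rule T.integrable_const_bound[where B = 1]) (use d_bd meas[OF d_cont] T.events_eq_borel in auto)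
  moreover have "AE x in \<tau>. 0 \<le> d x" by (simp add: d_def)
  ultimately have "AE x in \<tau>. d x = 0"
    using integral_nonneg_eq_0_iff_AE by blast
  then show suppT: "AE x in \<tau>. 0 \<le> x \<and> x \<le> C"
    by eventually_elim (use \<open>C \<ge> 0\<close> in \<open>auto simp: d_def clamp_def min_def max_def split: if_splits\<close>)
  have cj: "isCont (\<lambda>x. clamp x ^ j) x" for x by (intro continuous_intros cont)
  have bj: "norm (clamp x ^ j) \<le> C ^ j" for x
    using clamp_bd[of x] by (simp add: power_abs power_mono)
  have same: "(\<integral>x. clamp x ^ j \<partial>M) = (\<integral>x. x ^ j \<partial>M)"
    if "real_distribution M" "AE x in M. 0 \<le> x \<and> x \<le> C" for M
  proof -
    interpret real_distribution M by (rule that)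
    show ?thesis
    proof (rule integral_cong_AE)
      show "AE x in M. clamp x ^ j = x ^ j" using that(2) by eventually_elim (simp add: clamp)
    qed (use meas[OF cj] events_eq_borel in auto)
  qed
  show "(\<lambda>k. \<integral>x. x ^ j \<partial>\<nu> k) \<longlonglongrightarrow> (\<integral>x. x ^ j \<partial>\<tau>)"
    using lim[of "\<lambda>x. clamp x ^ j", OF cj bj] unfolding same[OF rd(1) supp] same[OF rd(2) suppT] .
qed

lemma AE_root_measure:
  assumes "\<forall>x\<in>#A. 0 \<le> x \<and> x \<le> C" "A \<noteq> {#}"
  shows "AE x in root_measure A. 0 \<le> x \<and> x \<le> C"
proof -
  interpret real_distribution "root_measure A" by (rule real_distribution_root_measure[OF assms(2)])
  have "(\<integral>x. indicator {0..C} x \<partial>root_measure A) = (\<Sum>x\<in>#A. indicator {0..C} x) / real (size A)"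
    by (rule integral_root_measure) simp
  also have "(\<Sum>x\<in>#A. indicator {0..C} x :: real) = (\<Sum>x\<in>#A. 1)"
    using assms(1) by (intro arg_cong[of _ _ sum_mset] image_mset_cong) auto
  finally have "prob {0..C} = 1"
    using assms(2) by simp
  then have "AE x in root_measure A. x \<in> {0..C}"
    by (subst (asm) prob_eq_1) auto
  then show ?thesis by eventually_elim simp
qed

lemma tight_root_measures:
  assumes "\<And>k. \<forall>x\<in>#A k. 0 \<le> x \<and> x \<le> C" "\<And>k. A k \<noteq> {#}"
  shows "tight (\<lambda>k. root_measure (A k))"
  unfolding tight_def
proof (intro conjI allI impI)
  fix \<epsilon> :: real assume "\<epsilon> > 0"
  have "measure (root_measure (A k)) {-1<..max C 0} > 1 - \<epsilon>" for k
  proof -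
    interpret real_distribution "root_measure (A k)" by (rule real_distribution_root_measure[OF assms(2)])
    have "AE x in root_measure (A k). x \<in> {-1<..max C 0}"
      using AE_root_measure[OF assms(1,2)[of k]] by eventually_elim auto
    then have "prob {-1<..max C 0} = 1" by (subst prob_eq_1) auto
    then show ?thesis using \<open>\<epsilon> > 0\<close> by simp
  qed
  moreover have "(-1::real) < max C 0" by simp
  ultimately show "\<exists>a b. a < b \<and> (\<forall>n. 1 - \<epsilon> < measure (root_measure (A n)) {a<..b})" by blast
qed (rule real_distribution_root_measure[OF assms(2)])

section \<open>Convergence of the zero distributions\<close>

text \<open>\<open>\<Prod>(1 - x X)\<close> over the zeros \<open>x\<close>: its logarithmic derivative generates the power sums of the zeros.\<close>
definition root_fps :: "real multiset \<Rightarrow> real fps" where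
  "root_fps A = fps_of_poly (reflect_poly (poly_of_roots A))"

lemma root_fps_empty [simp]: "root_fps {#} = 1"
  by (simp add: root_fps_def)

lemma reflect_poly_linear: "reflect_poly [:- x, 1:] = [:1, - x:]" for x :: real
  by (cases "x = 0") (simp_all add: reflect_poly_def)

lemma root_fps_add_mset: "root_fps (add_mset x A) = (1 - fps_const x * fps_X) * root_fps A"
  unfolding root_fps_def poly_of_roots_add_mset reflect_poly_mult reflect_poly_linear
  by (simp only: fps_of_poly_mult fps_of_poly_linear)

lemma root_fps_logarithmic_derivative:
  assumes "A \<noteq> {#}"
  shows "fps_X * fps_deriv (root_fps A)
    = - fps_const (real (size A)) * moment_series (root_measure A) * root_fps A"
proof -
  have "fps_X * fps_deriv (root_fps A) = - (\<Sum>x\<in>#A. geometric_tail x) * root_fps A" for A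
  proof (induction A)
    case (add x A)
    define u where "u = 1 - fps_const x * fps_X"
    have "fps_X * fps_deriv (root_fps (add_mset x A))
        = u * (fps_X * fps_deriv (root_fps A)) - (fps_const x * fps_X) * root_fps A"
      by (simp add: root_fps_add_mset u_def algebra_simps)
    also have "\<dots> = - ((\<Sum>x\<in>#A. geometric_tail x) * u + u * geometric_tail x) * root_fps A"
      unfolding add.IH u_def geometric_tail_mult by (simp add: algebra_simps)
    also have "\<dots> = - (\<Sum>x\<in>#add_mset x A. geometric_tail x) * root_fps (add_mset x A)"
      by (simp add: root_fps_add_mset flip: u_def) (simp add: algebra_simps)
    finally show ?case .
  qed simp
  moreover have "(\<Sum>x\<in>#A. geometric_tail x) = fps_const (real (size A)) * moment_series (root_measure A)"
  proof (rule fps_ext)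
    fix k
    have nth: "fps_nth (\<Sum>x\<in>#A. geometric_tail x) k = (\<Sum>x\<in>#A. fps_nth (geometric_tail x) k)"
      by (induction A) simp_all
    show "fps_nth (\<Sum>x\<in>#A. geometric_tail x) k = fps_nth (fps_const (real (size A)) * moment_series (root_measure A)) k"
      unfolding nth using assms by (simp add: geometric_tail_def moment_series_def integral_root_measure)
  qed
  ultimately show ?thesis by (simp del: fps_const_neg)
qed

text \<open>With \<open>\<beta> = N \<alpha>\<close> and \<open>b\<^sub>j = N a\<^sub>j\<close> the parameters of the explicit formula are
  \<open>M = \<beta> + N = (1 + \<alpha>) N\<close> and \<open>c\<^sub>j = 1 / (N a\<^sub>j)\<close>. The factor \<open>1 / N\<close> in \<open>c\<^sub>j\<close> becomes the scaling of the variable in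
  \<open>laguerre_transform\<close> and turns the general bound on the zeros into a constant.\<close>
lemma rescaled_laguerre_roots:
  fixes r :: nat and n :: "nat \<Rightarrow> nat" and a :: "nat \<Rightarrow> real" and \<alpha> :: real
  assumes a: "\<And>i. i \<in> {1..r} \<Longrightarrow> a0 \<le> a i" "a0 > 0" "inj_on a {1..r}" and \<alpha>: "\<alpha> \<ge> 0"
    and N: "(\<Sum>i=1..r. n i) = N" "N > 0"
  shows "\<exists>A. multiple_laguerre2 r n (real N * \<alpha>) (\<lambda>i. real N * a i) = poly_of_roots A \<and> size A = N \<and>
    (\<forall>x\<in>#A. 0 \<le> x \<and> x \<le> 2 * (2 + \<alpha>) / a0) \<and>
    root_fps A = laguerre_transform (real N) ((1 + \<alpha>) * real N)
      (\<Prod>j\<in>{1..r}. (1 - fps_const (1 / a j) * fps_X) ^ n j)"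
proof -
  define c where "c j = 1 / (real N * a j)" for j
  define cs where "cs = concat (map (\<lambda>j. replicate (n j) (c j)) [1..<Suc r])"
  define M where "M = (1 + \<alpha>) * real N"
  have apos: "a i > 0" if "i \<in> {1..r}" for i using a(1)[OF that] a(2) by simp
  have len: "length cs = N"
    using N(1) by (simp add: cs_def length_concat comp_def sum_list_distinct_conv_sum_set
        atLeastLessThanSuc_atLeastAtMost del: upt_Suc)
  have prod_cs: "(\<Prod>c\<leftarrow>cs. [:- c, 1:]) = (\<Prod>j=1..r. [:- (1 / (real N * a j)), 1:] ^ n j)"
  proof -
    have "(\<Prod>c\<leftarrow>concat (map (\<lambda>j. replicate (n j) (c j)) xs). [:- c, 1:]) = (\<Prod>j\<leftarrow>xs. [:- c j, 1:] ^ n j)" for xs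
      by (induction xs) (simp_all add: prod_list_replicate del: mult_pCons_left)
    moreover have "(\<Prod>j=1..r. [:- c j, 1:] ^ n j) = (\<Prod>j\<leftarrow>[1..<Suc r]. [:- c j, 1:] ^ n j)"
    proof -
      have "{1..r} = set [1..<Suc r]" by auto
      then have "(\<Prod>j=1..r. [:- c j, 1:] ^ n j) = (\<Prod>j\<in>set [1..<Suc r]. [:- c j, 1:] ^ n j)"
        by (simp only:)
      also have "\<dots> = (\<Prod>j\<leftarrow>[1..<Suc r]. [:- c j, 1:] ^ n j)"
        by (rule prod.distinct_set_conv_list[OF distinct_upt])
      finally show ?thesis .
    qed
    ultimately show ?thesis by (simp only: cs_def c_def)
  qed
  have L: "multiple_laguerre2 r n (real N * \<alpha>) (\<lambda>i. real N * a i) = laguerre_poly M cs"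
  proof -
    have inj: "inj_on (\<lambda>i. real N * a i) {1..r}"
    proof (rule inj_onI)
      fix i j assume "i \<in> {1..r}" "j \<in> {1..r}" "real N * a i = real N * a j"
      then show "i = j" using inj_onD[OF a(3), of i j] N(2) by simp
    qed
    have "multiple_laguerre2 r n (real N * \<alpha>) (\<lambda>i. real N * a i)
        = laguerre_poly (real N * \<alpha> + real (length cs)) cs"
      using apos N \<alpha> len prod_cs by (intro multiple_laguerre2_eq_laguerre_poly inj) auto
    also have "real N * \<alpha> + real (length cs) = M"
      by (simp add: M_def len algebra_simps)
    finally show ?thesis .
  qed
  define cmax where "cmax = 1 / (real N * a0)"
  have cmax: "cmax > 0" using N a by (simp add: cmax_def)
  have c: "\<forall>c\<in>set cs. 0 < c \<and> c \<le> cmax"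
  proof
    fix x assume "x \<in> set cs"
    then obtain j where j: "j \<in> {1..r}" and x: "x = c j"
      unfolding cs_def by (force simp del: upt_Suc)
    have "0 < c j" using N(2) apos[OF j] by (simp add: c_def)
    moreover have "c j \<le> cmax"
      unfolding c_def cmax_def using N(2) a(1)[OF j] a(2) by (simp add: frac_le mult_left_mono)
    ultimately show "0 < x \<and> x \<le> cmax" by (simp add: x)
  qed
  have "M > 0" unfolding M_def using N(2) \<alpha> by (intro mult_pos_pos) simp_all
  moreover have "real (length cs) \<le> M" using \<alpha> by (simp add: M_def len algebra_simps)
  ultimately obtain A where A: "laguerre_poly M cs = poly_of_roots A" "size A = N"
    "\<forall>x\<in>#A. 0 < x \<and> x < 2 * cmax * (M + real N)"
    using laguerre_poly_roots[OF _ _ c cmax, of M] len by auto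
  have bound: "2 * cmax * (M + real N) = 2 * (2 + \<alpha>) / a0"
    using N a by (simp add: cmax_def M_def field_simps)
  have "root_fps A = laguerre_transform (real N) M (\<Prod>j\<in>{1..r}. (1 - fps_const (1 / a j) * fps_X) ^ n j)"
  proof (rule fps_ext)
    fix k
    define D where "D = (\<Prod>c\<leftarrow>cs. [:- c, 1:])"
    have degD: "degree D = N"
      unfolding D_def prod_cs N(1)[symmetric] by (subst degree_prod_sum_eq) (auto simp: degree_power_eq)
    have reflD: "fps_of_poly (reflect_poly D) = (\<Prod>j=1..r. (1 - fps_const (c j) * fps_X) ^ n j)"
      by (simp only: D_def prod_cs reflect_poly_prod reflect_poly_power reflect_poly_linear
          fps_of_poly_prod fps_of_poly_power fps_of_poly_linear c_def)
    define Q where "Q = (\<Prod>j\<in>{1..r}. (1 - fps_const (1 / a j) * fps_X) ^ n j)"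
    define X' where "X' = fps_const (1 / real N) * fps_X"
    have X'0: "fps_nth X' 0 = 0" by (simp add: X'_def)
    have "fps_compose Q X' = (\<Prod>j\<in>{1..r}. (1 - fps_const (1 / a j) * X') ^ n j)"
      unfolding Q_def fps_compose_prod_distrib[OF X'0]
    proof (rule prod.cong)
      fix j
      have "fps_compose (1 - fps_const (1 / a j) * fps_X) X' = 1 - fps_const (1 / a j) * X'"
        by (simp only: fps_compose_sub_distrib fps_compose_mult_distrib[OF X'0] fps_compose_1
            fps_const_compose fps_X_fps_compose_startby0[OF X'0])
      then show "fps_compose ((1 - fps_const (1 / a j) * fps_X) ^ n j) X'
          = (1 - fps_const (1 / a j) * X') ^ n j"
        by (simp only: fps_compose_power[OF X'0, symmetric])
    qed simp
    also have "\<dots> = fps_of_poly (reflect_poly D)"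
      unfolding reflD
    proof (rule prod.cong)
      fix j
      have "c j = 1 / a j * (1 / real N)" by (simp add: c_def)
      then have "fps_const (1 / a j) * X' = fps_const (c j) * fps_X"
        by (simp only: X'_def mult.assoc[symmetric] fps_const_mult)
      then show "(1 - fps_const (1 / a j) * X') ^ n j = (1 - fps_const (c j) * fps_X) ^ n j" by simp
    qed simp
    finally have "fps_nth (fps_of_poly (reflect_poly D)) k = fps_nth (fps_compose Q X') k" by simp
    also have "\<dots> = fps_nth Q k / real N ^ k"
      by (simp add: X'_def fps_compose_linear power_divide)
    finally have Qk: "coeff (reflect_poly D) k = fps_nth Q k / real N ^ k" by simp
    have "fps_nth (root_fps A) k = coeff (reflect_poly D) k * falling_factorial M k"
    proof (cases "k \<le> N")
      case True
      have "fps_nth (root_fps A) k = coeff (laguerre_poly M cs) (N - k)"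
        using True A by (simp add: root_fps_def coeff_reflect_poly)
      also have "\<dots> = coeff D (N - k) * falling_factorial M (N - (N - k))"
        using coeff_laguerre_poly[of "N - k" cs M] len by (simp add: D_def)
      finally show ?thesis using True by (simp add: coeff_reflect_poly degD)
    next
      case False
      then show ?thesis using A by (simp add: root_fps_def coeff_reflect_poly degD)
    qed
    then show "fps_nth (root_fps A) k = fps_nth (laguerre_transform (real N) M Q) k"
      by (simp add: Qk laguerre_transform_def)
  qed
  then show ?thesis
    using A bound by (intro exI[of _ A]) (auto simp: L M_def intro: less_imp_le)
qed

lemma moment_series_atomic_measure:
  assumes "finite J" "\<And>j. j \<in> J \<Longrightarrow> q j \<ge> 0"
  shows "moment_series (atomic_measure J q c) = atomic_moment_series J q c"
  by (rule fps_ext)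
     (simp add: moment_series_def atomic_moment_series_def integral_atomic_measure[OF assms])

theorem theorem3p7:
  fixes r :: nat and a q :: "nat \<Rightarrow> real" and \<alpha> :: real and n :: "nat \<Rightarrow> nat \<Rightarrow> nat"
  assumes "r \<ge> 2"
    and "\<forall>i\<in>{1..r}. 0 < a i"
    and "inj_on a {1..r}"
    and "\<alpha> \<ge> 0"
    and "path_like r n q"
  shows "converges_weakly
    (\<lambda>N. zero_distribution (map_poly complex_of_real
            (multiple_laguerre2 r (n N) (real N * \<alpha>) (\<lambda>i. real N * a i))))
    (distr (free_mult_conv (marchenko_pastur (1 / (1 + \<alpha>)))
                           (atomic_measure {1..r} q (\<lambda>j. 1 / a j)))
       borel complex_of_real)"
proof -
  define J where "J = {1..r}"
  define l where "l = 1 + \<alpha>"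
  define \<eta> where "\<eta> = atomic_measure J q (\<lambda>j. 1 / a j)"
  define a0 where "a0 = Min (a ` J)"
  define C where "C = 2 * (2 + \<alpha>) / a0"
  have J: "finite J" "J \<noteq> {}" using assms(1) by (auto simp: J_def)
  have apos: "a j > 0" if "j \<in> J" for j using assms(2) that by (simp add: J_def)
  have a0: "a0 > 0" "\<And>j. j \<in> J \<Longrightarrow> a0 \<le> a j"
    using J apos by (auto simp: a0_def)
  have C: "C \<ge> 0" using a0 assms(4) by (simp add: C_def)
  have n_sum: "(\<Sum>i=1..r. n N i) = N" for N
    using assms(5) by (simp add: path_like_def)
  have q: "q j > 0" "(\<lambda>N. real (n N j) / real N) \<longlonglongrightarrow> q j" if "j \<in> J" for j
    using assms(5) that by (auto simp: path_like_def J_def)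
  have l: "l \<ge> 1" using assms(4) by (simp add: l_def)
  have "\<exists>A. multiple_laguerre2 r (n (Suc k)) (real (Suc k) * \<alpha>) (\<lambda>i. real (Suc k) * a i) = poly_of_roots A
      \<and> size A = Suc k \<and> (\<forall>x\<in>#A. 0 \<le> x \<and> x \<le> C) \<and>
      root_fps A = laguerre_transform (real (Suc k)) (l * real (Suc k))
        (\<Prod>j\<in>J. (1 - fps_const (1 / a j) * fps_X) ^ n (Suc k) j)" for k
    unfolding C_def l_def J_def using a0 assms(3,4) n_sum
    by (intro rescaled_laguerre_roots) (auto simp: J_def)
  then obtain A where A: "\<And>k. multiple_laguerre2 r (n (Suc k)) (real (Suc k) * \<alpha>) (\<lambda>i. real (Suc k) * a i)
        = poly_of_roots (A k)"
      "\<And>k. size (A k) = Suc k" "\<And>k. \<forall>x\<in>#A k. 0 \<le> x \<and> x \<le> C"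
      "\<And>k. root_fps (A k) = laguerre_transform (real (Suc k)) (l * real (Suc k))
        (\<Prod>j\<in>J. (1 - fps_const (1 / a j) * fps_X) ^ n (Suc k) j)"
    by metis
  have A_ne: "A k \<noteq> {#}" for k using A(2)[of k] by auto
  \<comment> \<open>The index is shifted by one because there are no zeros for \<open>N = 0\<close>.\<close>
  define \<nu> where "\<nu> k = root_measure (A k)" for k
  have rd: "real_distribution (\<nu> k)" for k
    unfolding \<nu>_def by (rule real_distribution_root_measure[OF A_ne])
  have supp: "AE x in \<nu> k. 0 \<le> x \<and> x \<le> C" for k
    unfolding \<nu>_def by (rule AE_root_measure[OF A(3) A_ne])
  have tight: "tight \<nu>"
    unfolding \<nu>_def[abs_def] by (rule tight_root_measures[OF A(3) A_ne])
  have \<eta>_series: "moment_series \<eta> = atomic_moment_series J q (\<lambda>j. 1 / a j)"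
    unfolding \<eta>_def using J q(1) by (intro moment_series_atomic_measure) (auto intro: less_imp_le)
  have \<eta>1: "fps_nth (moment_series \<eta>) 1 > 0"
    unfolding \<eta>_series using J q(1) apos by (auto simp: atomic_moment_series_def intro!: sum_pos)
  have limit: "admissible \<tau> \<and> S_transform \<tau> = S_transform (marchenko_pastur (1 / l)) * S_transform \<eta>"
    if t: "strict_mono t" and \<tau>: "real_distribution \<tau>" "weak_conv_m (\<nu> \<circ> t) \<tau>" for t \<tau>
  proof -
    note lim = weak_limit_support_and_moments[of "\<lambda>k. \<nu> (t k)" \<tau> C,
        OF rd \<tau>(1) \<tau>(2)[unfolded comp_def] supp C]
    have supp_\<tau>: "AE x in \<tau>. 0 \<le> x \<and> x \<le> C" by (rule lim(1))
    have "(\<lambda>k. \<integral>x. x ^ j \<partial>\<nu> (t k)) \<longlonglongrightarrow> (\<integral>x. x ^ j \<partial>\<tau>)" for j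
      by (rule lim(2))
    then have \<psi>: "fps_coeffwise_tendsto (\<lambda>k. moment_series (\<nu> (t k))) (moment_series \<tau>)"
      by (simp add: fps_coeffwise_tendsto_def moment_series_def)
    have Suc_t: "strict_mono (\<lambda>k. Suc (t k))" using t by (simp add: strict_mono_def)
    have eq: "moment_series \<tau>
        = fps_compose (moment_series \<eta>) (fps_X * (fps_const l + moment_series \<tau>))"
      unfolding \<eta>_series
    proof (rule moment_series_limit_equation[OF J(1) _ _ _ _ _ \<psi>])
      show "real (Suc (t k)) > 0" for k by simp
      show "(\<lambda>k. 1 / real (Suc (t k))) \<longlonglongrightarrow> 0"
        using LIMSEQ_subseq_LIMSEQ[OF lim_1_over_n Suc_t] by (simp add: comp_def)
      show "(\<lambda>k. real (n (Suc (t k)) j) / real (Suc (t k))) \<longlonglongrightarrow> q j" if "j \<in> J" for j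
        using LIMSEQ_subseq_LIMSEQ[OF q(2)[OF that] Suc_t] by (simp add: comp_def)
      show "fps_X * fps_deriv (root_fps (A (t k)))
          = - fps_const (real (Suc (t k))) * moment_series (\<nu> (t k)) * root_fps (A (t k))" for k
        using root_fps_logarithmic_derivative[OF A_ne[of "t k"]] unfolding A(2) \<nu>_def .
      show "root_fps (A (t k)) = laguerre_transform (real (Suc (t k))) (l * real (Suc (t k)))
          (\<Prod>j\<in>J. (1 - fps_const (1 / a j) * fps_X) ^ n (Suc (t k)) j)" for k
        by (rule A(4))
    qed
    have "fps_nth (moment_series \<tau>) 1 = fps_nth (moment_series \<eta>) 1 * l"
      by (subst eq) (simp add: fps_compose_nth moment_series_def)
    then have \<tau>1: "fps_nth (moment_series \<tau>) 1 \<noteq> 0" using \<eta>1 l by simp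
    have "S_transform \<tau> = inverse (fps_const l + fps_X) * S_transform \<eta>"
      using \<tau>1 \<eta>1 l by (intro S_transform_product[OF eq]) auto
    then have S: "S_transform \<tau> = S_transform (marchenko_pastur (1 / l)) * S_transform \<eta>"
      by (simp add: S_transform_marchenko_pastur[OF l])
    interpret T: real_distribution \<tau> by (rule \<tau>(1))
    have "\<tau> \<noteq> return borel 0"
    proof
      assume "\<tau> = return borel 0"
      then have "fps_nth (moment_series \<tau>) 1 = 0"
        by (simp add: moment_series_def integral_return)
      with \<tau>1 show False by simp
    qed
    moreover have "compact {0..C} \<and> {0..C} \<subseteq> {0..} \<and> (AE x in \<tau>. x \<in> {0..C})"
      using supp_\<tau> by (auto elim!: eventually_mono)
    ultimately have "admissible \<tau>"
      unfolding admissible_def using T.prob_space_axioms T.events_eq_borel by blast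
    with S show ?thesis by blast
  qed
  \<comment> \<open>One limit point shows that the free convolution exists; uniqueness then identifies all limit points with it.\<close>
  obtain t \<tau> where \<tau>: "strict_mono (t :: nat \<Rightarrow> nat)" "real_distribution \<tau>" "weak_conv_m (\<nu> \<circ> id \<circ> t) \<tau>"
    using tight_imp_convergent_subsubsequence[OF tight strict_mono_id] by blast
  then have lim_\<tau>: "admissible \<tau> \<and> S_transform \<tau> = S_transform (marchenko_pastur (1 / l)) * S_transform \<eta>"
    by (intro limit) simp_all
  then have conv_eq: "free_mult_conv (marchenko_pastur (1 / l)) \<eta> = \<tau>"
    by (intro free_mult_conv_eqI) auto
  have weak: "weak_conv_m \<nu> \<tau>"
  proof (rule tight_subseq_weak_converge[OF rd \<tau>(2) tight])
    fix s \<sigma> assume \<sigma>: "strict_mono (s :: nat \<Rightarrow> nat)" "real_distribution \<sigma>" "weak_conv_m (\<nu> \<circ> s) \<sigma>"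
    then have "free_mult_conv (marchenko_pastur (1 / l)) \<eta> = \<sigma>"
      using limit[OF \<sigma>] by (intro free_mult_conv_eqI) auto
    with \<sigma>(3) conv_eq show "weak_conv_m (\<nu> \<circ> s) \<tau>" by simp
  qed
  show ?thesis
    unfolding converges_weakly_def
  proof (intro allI impI)
    fix f :: "complex \<Rightarrow> real"
    assume f: "continuous_on UNIV f \<and> bounded (range f)"
    then obtain B where B: "\<And>z. norm (f z) \<le> B" by (auto simp: bounded_iff)
    have f_meas: "f \<in> borel_measurable borel"
      using f by (intro borel_measurable_continuous_onI) auto
    define g where "g x = f (complex_of_real x)" for x
    have g_cont: "continuous_on UNIV g"
      unfolding g_def
      by (rule continuous_on_compose2[OF conjunct1[OF f] continuous_on_of_real_id]) simp
    then have g_meas: "g \<in> borel_measurable borel" by (intro borel_measurable_continuous_onI)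
    have "(\<lambda>k. \<integral>x. g x \<partial>\<nu> k) \<longlonglongrightarrow> (\<integral>x. g x \<partial>\<tau>)"
    proof (rule weak_conv_imp_integral_bdd_continuous_conv[OF rd \<tau>(2) weak])
      show "isCont g x" for x using g_cont by (simp add: continuous_on_eq_continuous_at)
      show "norm (g x) \<le> B" for x unfolding g_def by (rule B)
    qed
    moreover have "(\<integral>x. g x \<partial>\<nu> k) = (\<integral>z. f z \<partial>zero_distribution (map_poly complex_of_real
        (multiple_laguerre2 r (n (Suc k)) (real (Suc k) * \<alpha>) (\<lambda>i. real (Suc k) * a i))))" for k
      unfolding A(1) \<nu>_def integral_zero_distribution[OF f_meas] integral_root_measure[OF g_meas]
      by (simp add: g_def[abs_def])
    moreover have "(\<integral>x. g x \<partial>\<tau>) = (\<integral>z. f z \<partial>distr \<tau> borel complex_of_real)"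
    proof -
      interpret T: real_distribution \<tau> by (rule \<tau>(2))
      show ?thesis
        unfolding g_def using f_meas by (intro integral_distr[symmetric]) simp_all
    qed
    ultimately have "(\<lambda>k. \<integral>z. f z \<partial>zero_distribution (map_poly complex_of_real
        (multiple_laguerre2 r (n (Suc k)) (real (Suc k) * \<alpha>) (\<lambda>i. real (Suc k) * a i))))
        \<longlonglongrightarrow> (\<integral>z. f z \<partial>distr \<tau> borel complex_of_real)"
      by simp
    then show "(\<lambda>N. \<integral>z. f z \<partial>zero_distribution (map_poly complex_of_real
        (multiple_laguerre2 r (n N) (real N * \<alpha>) (\<lambda>i. real N * a i))))
        \<longlonglongrightarrow> (\<integral>z. f z \<partial>distr (free_mult_conv (marchenko_pastur (1 / (1 + \<alpha>)))
                           (atomic_measure {1..r} q (\<lambda>j. 1 / a j))) borel complex_of_real)"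
      unfolding conv_eq[unfolded l_def \<eta>_def J_def] by (rule LIMSEQ_imp_Suc)
  qed
qed

end
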